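(* Let $M\in\mathbb{N}$, $M\ge1$, $|c|=1$, and let $L(s)\in\mathbb{C}\{s\}$ with $L(0)=0$ satisfy one of the following: (curve type) $M=1$ and all coefficients of $L$ are purely imaginary; or (isolated type) $L(s)=iA_0(s^M)+s^{2MK}L_1(s)$ with $K\in\mathbb{N}$, $K\ge1$, $A_0\in\mathbb{R}[s]$ of degree less than $2K$, $L_1\in\mathbb{C}\{s\}$, $\Re L_1(0)>0$. Consider the parametrization, for $s\in\mathbb{C}$ near $0$, $$s\mapsto\gamma(s)=\left(cs^Me^{ML(s)},\ is^{2M}+i2M\int_{[0,s]}x^{2M}L'(x)\,dx\right).$$ If $\gamma$ is algebraic, then $f(s)=e^{L(s)}$ is an algebraic function whose analytic continuation has no zeros or poles (nor algebraic zeros/poles) over points of $\mathbb{C}_*=\mathbb{C}\setminus\{0\}$. In addition, the Puiseux–Laurent series of (any analytic continuation of) $f'(1/s)/f(1/s)$ around $s=0$ cannot contain the term $s^{2M+1}$ (i.e. the coefficient of $s^{2M+1}$ is zero).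
   Context: $\mathbb{C}\{s\}$ is the ring of convergent power series centered at $0$; $\int_{[0,s]}$ is the integral over the segment from $0$ to $s$. "$\gamma$ is algebraic" means that the image of $\gamma$ lies in the zero set of an irreducible polynomial $p\in\mathbb{C}[z,w]$, i.e. $p(\gamma(s))\equiv0$ for $s$ near $0$. An algebraic function is an analytic germ $f$ satisfying $P(s,f(s))\equiv0$ for some nonzero polynomial $P\in\mathbb{C}[s,y]$ of positive degree in $y$; it continues analytically along all paths in the Riemann sphere avoiding a finite set. Algebraic zero or pole: at a branch point $s_0$, a continuation of $f$ has a Puiseux–Laurent expansion $\sum_{j=n}^\infty a_j(s-s_0)^{j/k}$ with $a_n\ne0$; it has an algebraic zero at $s_0$ if $n>0$ and an algebraic pole if $n<0$. In $f'(1/s)/f(1/s)$, $f'/f$ is the logarithmic derivative of $f$ evaluated at $1/s$, so the expansion around $s=0$ describes $f'/f$ at infinity; it is a series in powers of $s^{1/k}$ for some $k\geq 1$ with finitely many negative exponents. *)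

theory Defs
  imports "HOL-Complex_Analysis.Complex_Analysis"
    "HOL-Computational_Algebra.Computational_Algebra"
begin

text \<open>
  Germs of analytic functions at a point \<open>a\<close> are represented by functions on the complex plane,
  of which only the values near \<open>a\<close> matter. The ring of convergent power series at \<open>0\<close> is
  represented by the formal power series of positive radius of convergence.
\<close>

definition convergent_fps :: "complex fps \<Rightarrow> bool" where
  "convergent_fps F \<longleftrightarrow> fps_conv_radius F > 0"

text \<open>
  Polynomials in two variables are polynomials in the second variable with coefficients that
  are polynomials in the first one.
\<close>

definition eval_bipoly :: "complex poly poly \<Rightarrow> complex \<Rightarrow> complex \<Rightarrow> complex" where
  "eval_bipoly P x y = poly (map_poly (\<lambda>q. poly q x) P) y"


definition curve_type :: "nat \<Rightarrow> complex fps \<Rightarrow> bool" where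
  "curve_type M L \<longleftrightarrow> M = 1 \<and> (\<forall>n. Re (fps_nth L n) = 0)"

definition isolated_type :: "nat \<Rightarrow> complex fps \<Rightarrow> bool" where
  "isolated_type M L \<longleftrightarrow>
     (\<exists>(K::nat) (A0::real poly) (L1::complex fps).
        K \<ge> 1 \<and> degree A0 < 2 * K \<and> convergent_fps L1 \<and> Re (fps_nth L1 0) > 0 \<and>
        L = fps_const \<i> * (fps_of_poly (map_poly complex_of_real A0) oo fps_X ^ M)
            + fps_X ^ (2 * M * K) * L1)"

definition gamma_param :: "complex \<Rightarrow> nat \<Rightarrow> complex fps \<Rightarrow> complex \<Rightarrow> complex \<times> complex" where
  "gamma_param c M L s =
     (c * s ^ M * exp (of_nat M * eval_fps L s),
      \<i> * s ^ (2 * M) + \<i> * 2 * of_nat M *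
        contour_integral (linepath 0 s) (\<lambda>x. x ^ (2 * M) * eval_fps (fps_deriv L) x))"

definition algebraic_param :: "(complex \<Rightarrow> complex \<times> complex) \<Rightarrow> bool" where
  "algebraic_param \<gamma> \<longleftrightarrow>
     (\<exists>p::complex poly poly. irreducible p \<and>
        (\<forall>\<^sub>F s in nhds 0. eval_bipoly p (fst (\<gamma> s)) (snd (\<gamma> s)) = 0))"

definition algebraic_function :: "(complex \<Rightarrow> complex) \<Rightarrow> complex \<Rightarrow> bool" where
  "algebraic_function f a \<longleftrightarrow> f analytic_on {a} \<and>
     (\<exists>P::complex poly poly. P \<noteq> 0 \<and> degree P > 0 \<and>
        (\<forall>\<^sub>F s in nhds a. eval_bipoly P s (f s) = 0))"

text \<open>
  The germ \<open>g\<close> at the end of the path \<open>p\<close> is the analytic continuation along \<open>p\<close> of the germ \<open>f\<close>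
  at the start of \<open>p\<close>; \<open>G t\<close> is the germ at \<open>p t\<close>. Paths run in the finite plane: a path on the
  Riemann sphere through infinity along which the germ continues can be deformed slightly to
  avoid infinity without changing the germ at its end.
\<close>

definition continues_along ::
  "(complex \<Rightarrow> complex) \<Rightarrow> (real \<Rightarrow> complex) \<Rightarrow> (complex \<Rightarrow> complex) \<Rightarrow> bool" where
  "continues_along f p g \<longleftrightarrow> path p \<and>
     (\<exists>G::real \<Rightarrow> complex \<Rightarrow> complex.
        (\<forall>t\<in>{0..1}. G t analytic_on {p t} \<and>
           (\<exists>e>0. \<forall>u\<in>{0..1}. \<bar>u - t\<bar> < e \<longrightarrow> (\<forall>\<^sub>F z in nhds (p u). G u z = G t z))) \<and>
        (\<forall>\<^sub>F z in nhds (pathstart p). G 0 z = f z) \<and>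
        (\<forall>\<^sub>F z in nhds (pathfinish p). G 1 z = g z))"

text \<open>
  The germ \<open>g\<close> at \<open>a\<close> belongs to a branch over a punctured disc around \<open>s0\<close> (containing \<open>a\<close>)
  that has the Puiseux--Laurent series with terms \<open>fls_nth F j * (s - s0) powr (j / k)\<close>. The
  uniformizing variable \<open>t\<close> satisfies \<open>s = s0 + t ^ k\<close>, and \<open>t1\<close> is the choice of the \<open>k\<close>-th root
  of \<open>a - s0\<close> that selects the germ \<open>g\<close>. For \<open>k = 1\<close> this is an ordinary Laurent series, and
  \<open>k\<close> need not be minimal.
\<close>

definition puiseux_expansion ::
  "(complex \<Rightarrow> complex) \<Rightarrow> complex \<Rightarrow> complex \<Rightarrow> nat \<Rightarrow> complex fls \<Rightarrow> bool" where
  "puiseux_expansion g a s0 k F \<longleftrightarrow> k \<ge> 1 \<and>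
     (\<exists>t1. t1 \<noteq> 0 \<and> ereal (norm t1) < fls_conv_radius F \<and> t1 ^ k = a - s0 \<and>
        (\<forall>\<^sub>F t in nhds t1. g (s0 + t ^ k) = eval_fls F t))"

text \<open>
  Some continuation of the germ \<open>f\<close> at \<open>0\<close> has a zero (a pole) or an algebraic zero
  (an algebraic pole) over \<open>s0\<close>. The case \<open>k = 1\<close> covers ordinary zeros and poles.
\<close>

definition has_zero_over :: "(complex \<Rightarrow> complex) \<Rightarrow> complex \<Rightarrow> bool" where
  "has_zero_over f s0 \<longleftrightarrow>
     (\<exists>p g k F. pathstart p = 0 \<and> continues_along f p g \<and>
        puiseux_expansion g (pathfinish p) s0 k F \<and> F \<noteq> 0 \<and> fls_subdegree F > 0)"

definition has_pole_over :: "(complex \<Rightarrow> complex) \<Rightarrow> complex \<Rightarrow> bool" where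
  "has_pole_over f s0 \<longleftrightarrow>
     (\<exists>p g k F. pathstart p = 0 \<and> continues_along f p g \<and>
        puiseux_expansion g (pathfinish p) s0 k F \<and> F \<noteq> 0 \<and> fls_subdegree F < 0)"

text \<open>
  Some continuation \<open>g\<close> of the germ \<open>h\<close> at \<open>0\<close> to a point near infinity is such that
  \<open>g (1 / s)\<close> has the given Puiseux--Laurent series around \<open>s = 0\<close>.
\<close>

definition puiseux_at_infinity :: "(complex \<Rightarrow> complex) \<Rightarrow> nat \<Rightarrow> complex fls \<Rightarrow> bool" where
  "puiseux_at_infinity h k F \<longleftrightarrow>
     (\<exists>p g. pathstart p = 0 \<and> continues_along h p g \<and>
        puiseux_expansion (\<lambda>s. g (1 / s)) (1 / pathfinish p) 0 k F)"

end

(*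
  Put z = c s^M f^M, S = s^(2M), and let w be the second component of the curve. Then
  w' z = 2 i S z', so differentiating P(z, w) = 0 shows that S, and with it f^(2M) = z^2 / (c^2 S),
  is a rational function on the curve P = 0. Any two rational functions on a curve are
  algebraically dependent, by a dimension count. Hence f and w are algebraic functions of s.

  Now dw = 2 M i (s^(2M-1) + s^(2M) f'/f) ds, and a continuation of w around a point takes only
  finitely many values, so dw has no residue in the uniformizing variable of a Puiseux series.
  Over s0 this residue is 2 M i s0^(2M) n, where n is the order of f; over infinity it is a nonzero
  multiple of the coefficient of s^(2M+1) in the expansion of f'(1/s)/f(1/s).
*)

theory Submission
  imports Defs
begin

text \<open>Solving for \<open>S\<close> takes a relation \<open>Q\<close> whose derivative in
  \<open>w\<close> does not vanish on the curve: then z' (z Q_z + 2 i S Q_w) = 0 gives S = - z Q_z /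
  (2 i Q_w). Such a \<open>Q\<close> arises from \<open>P\<close> by repeated differentiation in
  \<open>w\<close>.

  Continuations are not constructed: the notions of zero, pole and expansion at infinity supply
  them, and a property is transported along the given path. A primitive is determined only up to a
  constant, so this property refers to the germ of f'/f alone: near the point some primitive of the
  form satisfies the fixed relation \<open>R\<close>. A continuation of f may a priori run through
  zeros, where f'/f has poles, so the property is carried along on punctured neighbourhoods.

  A Puiseux series meets the continued germ at a point \<open>t1\<close> of the uniformizing disc
  that need not be close to 0. The pulled-back form is therefore considered on a connected open set
  joining \<open>t1\<close> to a punctured disc around 0, where its residue is read off. The factor
  s0^(2M) in this residue is why nothing is claimed over s0 = 0.\<close>

section \<open>Bivariate polynomials evaluated at formal power series\<close>

definition eval2 :: "complex poly poly \<Rightarrow> complex fps \<Rightarrow> complex fps \<Rightarrow> complex fps" where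
  "eval2 P x y = poly (map_poly (\<lambda>q. poly (map_poly fps_const q) x) P) y"

lemma poly_fps_const_pCons:
  "poly (map_poly fps_const (pCons a q)) x = fps_const a + x * poly (map_poly fps_const q) x"
  by (simp add: map_poly_pCons)

lemma eval2_0 [simp]: "eval2 0 x y = 0"
  by (simp add: eval2_def)

lemma eval2_pCons [simp]:
  "eval2 (pCons q P) x y = poly (map_poly fps_const q) x + y * eval2 P x y"
  by (simp add: eval2_def map_poly_pCons)

lemma poly_fps_const_add:
  "poly (map_poly fps_const (p + q)) x = poly (map_poly fps_const p) x + poly (map_poly fps_const q) x"
  for x :: "complex fps"
proof -
  have "map_poly fps_const (p + q) = map_poly fps_const p + map_poly fps_const q"
    by (simp add: poly_eq_iff coeff_map_poly)
  then show ?thesis by simp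
qed

lemma eval2_add: "eval2 (P + Q) x y = eval2 P x y + eval2 Q x y"
proof -
  have "map_poly (\<lambda>q. poly (map_poly fps_const q) x) (P + Q) =
      map_poly (\<lambda>q. poly (map_poly fps_const q) x) P + map_poly (\<lambda>q. poly (map_poly fps_const q) x) Q"
    by (simp add: poly_eq_iff coeff_map_poly poly_fps_const_add)
  then show ?thesis by (simp add: eval2_def)
qed

lemma eval2_monom: "eval2 (monom (monom a i) j) x y = fps_const a * x ^ i * y ^ j"
  by (simp add: eval2_def map_poly_monom poly_monom)

lemma eval2_sum: "eval2 (\<Sum>i\<in>I. P i) x y = (\<Sum>i\<in>I. eval2 (P i) x y)"
  by (induction I rule: infinite_finite_induct) (auto simp: eval2_add)

lemma fps_deriv_poly_fps_const:
  "fps_deriv (poly (map_poly fps_const q) x) = poly (map_poly fps_const (pderiv q)) x * fps_deriv x"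
  for x :: "complex fps"
  by (induction q) (auto simp: poly_fps_const_pCons pderiv_pCons poly_fps_const_add algebra_simps)

lemma map_poly_pderiv_pCons: "map_poly pderiv (pCons q P) = pCons (pderiv q) (map_poly pderiv P)"
  for P :: "complex poly poly"
  by (simp add: map_poly_pCons)

text \<open>Chain rule. The outer variable is the second one, so \<open>map_poly pderiv P\<close> is
  the partial derivative in the first variable and \<open>pderiv P\<close> the one in the
  second.\<close>

lemma eval2_deriv:
  "fps_deriv (eval2 P x y) =
     eval2 (map_poly pderiv P) x y * fps_deriv x + eval2 (pderiv P) x y * fps_deriv y"
proof (induction P)
  case (pCons q P)
  show ?case
    by (simp add: map_poly_pderiv_pCons pderiv_pCons eval2_add fps_deriv_poly_fps_const pCons.IH algebra_simps)
qed auto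

text \<open>For positive \<open>m\<close> and \<open>n\<close> the map (i, j) to (m i, n j) is
  injective, so no two monomials of the given relation merge in \<open>R\<close> and the nonzero
  coefficient survives.\<close>

lemma eval2_relation_of_sum:
  assumes "finite I" "(i0, j0) \<in> I" "c (i0, j0) \<noteq> 0" "m > 0" "n > 0"
    and "(\<Sum>(i, j)\<in>I. fps_const (c (i, j)) * (x ^ m) ^ i * (y ^ n) ^ j) = 0"
  shows "\<exists>R. R \<noteq> 0 \<and> eval2 R x y = 0"
proof (intro exI conjI)
  define R where "R = (\<Sum>(i, j)\<in>I. monom (monom (c (i, j)) (m * i)) (n * j))"
  have "coeff (coeff R (n * j0)) (m * i0) =
      (\<Sum>(i, j)\<in>I. if (i, j) = (i0, j0) then c (i, j) else 0)"
    unfolding R_def coeff_sum using assms(4,5)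
    by (intro sum.cong) (auto simp: coeff_monom split: if_splits)
  also have "\<dots> = (\<Sum>q\<in>I. if q = (i0, j0) then c q else 0)"
    by (intro sum.cong refl) (auto split: if_splits)
  also have "\<dots> = c (i0, j0)"
    using assms(1,2) by simp
  finally show "R \<noteq> 0"
    using assms(3) by auto
  show "eval2 R x y = 0"
    unfolding R_def eval2_sum assms(6)[symmetric]
    by (intro sum.cong) (auto simp: eval2_monom power_mult)
qed

section \<open>Degree filtration and dimension count on the curve\<close>

lemma fps_vector_space: "vector_space (\<lambda>(c::complex) F. fps_const c * F)"
  by standard (auto simp: algebra_simps fps_const_add[symmetric] fps_const_mult[symmetric]
      simp del: fps_const_add fps_const_mult)

interpretation cfps: vector_space "\<lambda>(c::complex) F. fps_const c * F"
  by (rule fps_vector_space)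

text \<open>Linear dependence of an indexed family rather than of a set: if \<open>v\<close> repeats
  a value, its image may well be independent, and the relation is then
  \<open>v i - v j = 0\<close>.\<close>

lemma relation_of_span_card:
  assumes "finite I" "finite T" "card T < card I" "\<And>i. i \<in> I \<Longrightarrow> v i \<in> cfps.span T"
  shows "\<exists>c. (\<exists>i\<in>I. c i \<noteq> 0) \<and> (\<Sum>i\<in>I. fps_const (c i) * v i) = 0"
proof (cases "inj_on v I")
  case True
  have "cfps.dependent (v ` I)"
  proof (rule ccontr)
    assume "\<not> cfps.dependent (v ` I)"
    then have "card (v ` I) \<le> card T"
      using cfps.independent_span_bound[OF assms(2)] assms(4) by blast
    then show False
      using assms(3) card_image[OF True] by simp
  qed
  then obtain u where u: "\<exists>q\<in>v ` I. u q \<noteq> 0" "(\<Sum>q\<in>v ` I. fps_const (u q) * q) = 0"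
    using cfps.dependent_finite[of "v ` I"] assms(1) by auto
  then show ?thesis
    using sum.reindex[OF True, of "\<lambda>q. fps_const (u q) * q"]
    by (intro exI[of _ "u \<circ> v"]) auto
next
  case False
  then obtain i j where ij: "i \<in> I" "j \<in> I" "i \<noteq> j" "v i = v j"
    by (auto simp: inj_on_def)
  define c :: "_ \<Rightarrow> complex" where "c = (\<lambda>_. 0)(i := 1, j := - 1)"
  have "(\<Sum>k\<in>I. fps_const (c k) * v k) = (\<Sum>k\<in>{i, j}. fps_const (c k) * v k)"
    using ij assms(1) by (intro sum.mono_neutral_right) (auto simp: c_def)
  also have "\<dots> = 0"
    using ij by (auto simp: c_def)
  finally show ?thesis
    using ij by (intro exI[of _ c]) (auto simp: c_def)
qed

text \<open>The filtration by total degree of the algebra of polynomial functions on the curve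
  parametrized by (z, w).\<close>

definition poly_span :: "complex fps \<Rightarrow> complex fps \<Rightarrow> nat \<Rightarrow> complex fps set" where
  "poly_span z w N = cfps.span ((\<lambda>(i, j). z ^ i * w ^ j) ` {(i, j). i + j \<le> N})"

lemma poly_span_monomial: "i + j \<le> N \<Longrightarrow> z ^ i * w ^ j \<in> poly_span z w N"
  unfolding poly_span_def by (rule cfps.span_base) auto

lemma poly_span_mono: "N \<le> N' \<Longrightarrow> poly_span z w N \<subseteq> poly_span z w N'"
  unfolding poly_span_def by (rule cfps.span_mono) auto

lemma poly_span_mult_monomial:
  assumes "F \<in> poly_span z w N" "i + j \<le> N'"
  shows "F * (z ^ i * w ^ j) \<in> poly_span z w (N + N')"
  using assms(1) unfolding poly_span_def
proof (induction rule: cfps.span_induct_alt)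
  case base
  then show ?case by (simp add: cfps.span_zero)
next
  case (step c m G)
  then obtain k l where kl: "m = z ^ k * w ^ l" "k + l \<le> N" by auto
  have "m * (z ^ i * w ^ j) = z ^ (k + i) * w ^ (l + j)"
    by (simp add: kl power_add mult_ac)
  then have "m * (z ^ i * w ^ j) \<in> poly_span z w (N + N')"
    using poly_span_monomial[of "k + i" "l + j" "N + N'"] kl assms by simp
  then show ?case
    unfolding poly_span_def
    using step.IH cfps.span_add cfps.span_scale[of "m * (z ^ i * w ^ j)" _ c]
    by (simp add: ring_distribs mult.assoc)
qed

lemma poly_span_mult:
  assumes "F \<in> poly_span z w N" "G \<in> poly_span z w N'"
  shows "F * G \<in> poly_span z w (N + N')"
  using assms(2) unfolding poly_span_def[of z w N']
proof (induction rule: cfps.span_induct_alt)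
  case base
  then show ?case by (simp add: poly_span_def cfps.span_zero)
next
  case (step c m G)
  then obtain k l where kl: "m = z ^ k * w ^ l" "k + l \<le> N'" by auto
  have "F * m \<in> poly_span z w (N + N')"
    using poly_span_mult_monomial[OF assms(1) kl(2)] kl(1) by simp
  then show ?case
    using step.IH cfps.span_add cfps.span_scale[of "F * m" _ c]
    unfolding poly_span_def by (simp add: ring_distribs mult.left_commute)
qed

lemma poly_span_1: "1 \<in> poly_span z w N"
  using poly_span_monomial[of 0 0 N z w] by simp

lemma poly_span_power: "F \<in> poly_span z w N \<Longrightarrow> F ^ n \<in> poly_span z w (n * N)"
  by (induction n) (auto simp: poly_span_1 intro: poly_span_mult)

lemma poly_span_add: "F \<in> poly_span z w N \<Longrightarrow> G \<in> poly_span z w N \<Longrightarrow> F + G \<in> poly_span z w N"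
  unfolding poly_span_def by (rule cfps.span_add)

lemma poly_span_scale: "F \<in> poly_span z w N \<Longrightarrow> fps_const c * F \<in> poly_span z w N"
  unfolding poly_span_def by (rule cfps.span_scale)

text \<open>The algebra generated by \<open>z\<close> and \<open>w\<close>. A rational function on
  the curve is later represented by a series \<open>x\<close> with a denominator
  \<open>B \<noteq> 0\<close> such that \<open>B\<close> and \<open>x * B\<close> both lie in this
  algebra; no quotient field is formed.\<close>

definition poly_values :: "complex fps \<Rightarrow> complex fps \<Rightarrow> complex fps set" where
  "poly_values z w = (\<Union>N. poly_span z w N)"

lemma poly_values_mult:
  "F \<in> poly_values z w \<Longrightarrow> G \<in> poly_values z w \<Longrightarrow> F * G \<in> poly_values z w"
  unfolding poly_values_def by (blast intro: poly_span_mult)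

lemma poly_values_add:
  assumes "F \<in> poly_values z w" "G \<in> poly_values z w"
  shows "F + G \<in> poly_values z w"
proof -
  obtain N N' where "F \<in> poly_span z w N" "G \<in> poly_span z w N'"
    using assms unfolding poly_values_def by blast
  then have "F + G \<in> poly_span z w (max N N')"
    using poly_span_mono[of N "max N N'" z w] poly_span_mono[of N' "max N N'" z w]
    by (intro poly_span_add) auto
  then show ?thesis unfolding poly_values_def by blast
qed

lemma poly_values_const: "fps_const c \<in> poly_values z w"
  using poly_span_scale[OF poly_span_1, of c] unfolding poly_values_def by fastforce

lemma poly_values_fst: "z \<in> poly_values z w"
  using poly_span_monomial[of 1 0 1 z w] unfolding poly_values_def by auto

lemma poly_values_snd: "w \<in> poly_values z w"
  using poly_span_monomial[of 0 1 1 z w] unfolding poly_values_def by auto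

lemma poly_fps_const_in_poly_values: "poly (map_poly fps_const q) z \<in> poly_values z w"
proof (induction q)
  case 0
  then show ?case using poly_values_const[of 0] by simp
next
  case (pCons a q)
  then show ?case
    by (auto simp: poly_fps_const_pCons intro!: poly_values_add poly_values_const poly_values_mult poly_values_fst)
qed

lemma eval2_in_poly_values: "eval2 P z w \<in> poly_values z w"
proof (induction P)
  case 0
  then show ?case using poly_values_const[of 0] by simp
next
  case (pCons a q)
  then show ?case
    by (auto intro!: poly_values_add poly_fps_const_in_poly_values poly_values_mult poly_values_snd)
qed

lemma eval2_eq_sum:
  obtains S where "finite S" "S = {(i, j). coeff (coeff P j) i \<noteq> 0}"
    "\<And>x y. eval2 P x y = (\<Sum>(i, j)\<in>S. fps_const (coeff (coeff P j) i) * x ^ i * y ^ j)"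
proof -
  define S where "S = {(i, j). coeff (coeff P j) i \<noteq> 0}"
  define d where "d = degree P"
  define e where "e = Max ((\<lambda>j. degree (coeff P j)) ` {..d})"
  have sub: "S \<subseteq> {..e} \<times> {..d}"
  proof
    fix q assume "q \<in> S"
    then obtain i j where q: "q = (i, j)" "coeff (coeff P j) i \<noteq> 0" by (auto simp: S_def)
    then have j: "j \<le> d" unfolding d_def by (metis coeff_0 le_degree)
    have "i \<le> degree (coeff P j)" using q by (simp add: le_degree)
    also have "\<dots> \<le> e" unfolding e_def using j by (intro Max_ge) auto
    finally show "q \<in> {..e} \<times> {..d}" using q j by auto
  qed
  then have fin: "finite S" by (rule finite_subset) auto
  have "eval2 P x y = (\<Sum>(i, j)\<in>S. fps_const (coeff (coeff P j) i) * x ^ i * y ^ j)" for x y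
  proof -
    have P: "P = (\<Sum>(i, j)\<in>S. monom (monom (coeff (coeff P j) i) i) j)"
    proof (intro poly_eqI)
      fix b a
      have "coeff (coeff (\<Sum>(i, j)\<in>S. monom (monom (coeff (coeff P j) i) i) j) b) a
        = (\<Sum>(i, j)\<in>S. if (i, j) = (a, b) then coeff (coeff P j) i else 0)"
        unfolding coeff_sum by (intro sum.cong) (auto simp: coeff_monom split: if_splits)
      also have "\<dots> = (\<Sum>q\<in>S. if q = (a, b) then coeff (coeff P b) a else 0)"
        by (intro sum.cong refl) (auto split: if_splits)
      also have "\<dots> = coeff (coeff P b) a"
        using fin by (auto simp: S_def)
      finally show "coeff (coeff P b) a =
        coeff (coeff (\<Sum>(i, j)\<in>S. monom (monom (coeff (coeff P j) i) i) j) b) a" ..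
    qed
    show ?thesis
      by (subst P, subst eval2_sum) (auto simp: eval2_monom intro!: sum.cong)
  qed
  then show ?thesis using that fin S_def by blast
qed

text \<open>
  Division by \<open>P\<close> with respect to the graded order on monomials, whose leading monomial in \<open>P\<close> is
  \<open>z ^ a * w ^ b\<close>: the remainders of degree at most \<open>N\<close> span a space of dimension linear in \<open>N\<close>.
\<close>

lemma poly_span_dimension_linear:
  assumes "P \<noteq> 0" "eval2 P z w = 0"
  obtains d :: nat where
    "\<And>N. \<exists>T. finite T \<and> card T \<le> d * (N + 1) \<and> poly_span z w N \<subseteq> cfps.span T"
proof -
  obtain S where S: "finite S" "S = {(i, j). coeff (coeff P j) i \<noteq> 0}"
    "\<And>x y. eval2 P x y = (\<Sum>(i, j)\<in>S. fps_const (coeff (coeff P j) i) * x ^ i * y ^ j)"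
    using eval2_eq_sum by blast
  define p where "p = (\<lambda>(i, j). coeff (coeff P j) i)"
  have "S \<noteq> {}"
  proof -
    obtain j where "coeff P j \<noteq> 0" using assms(1) by (metis leading_coeff_0_iff)
    then obtain i where "coeff (coeff P j) i \<noteq> 0" by (metis leading_coeff_0_iff)
    then show ?thesis using S(2) by auto
  qed
  define D where "D = Max ((\<lambda>(i, j). i + j) ` S)"
  define S' where "S' = {q \<in> S. fst q + snd q = D}"
  have "D \<in> (\<lambda>(i, j). i + j) ` S" unfolding D_def using S(1) \<open>S \<noteq> {}\<close> by (intro Max_in) auto
  then have S': "S' \<noteq> {}" "finite S'" using S(1) by (auto simp: S'_def)
  \<comment> \<open>Ties in total degree are broken by the larger exponent of
    \<open>z\<close>.\<close>
  define a where "a = Max (fst ` S')"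
  have "a \<in> fst ` S'" unfolding a_def using S' by (intro Max_in) auto
  then obtain b where ab: "(a, b) \<in> S'" by auto
  have abS: "(a, b) \<in> S" "a + b = D" using ab by (auto simp: S'_def)
  have leD: "i + j \<le> D" if "(i, j) \<in> S" for i j
    unfolding D_def using S(1) that by (intro Max_ge) auto
  have lead: "i + j < a + b \<or> i + j = a + b \<and> i < a" if "(i, j) \<in> S - {(a, b)}" for i j
  proof (cases "i + j = D")
    case True
    then have "(i, j) \<in> S'" using that by (auto simp: S'_def)
    then have "i \<le> a" unfolding a_def using S' by (metis Max_ge finite_imageI fst_conv imageI)
    then show ?thesis using True abS that by auto
  next
    case False
    then show ?thesis using leD[of i j] that abS by auto
  qed
  define mon where "mon = (\<lambda>(i, j). z ^ i * w ^ j)"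
  \<comment> \<open>The monomials that the leading monomial does not divide.\<close>
  define Red where "Red = (\<lambda>N. {(k, l). k + l \<le> N \<and> \<not> (a \<le> k \<and> b \<le> l)})"
  have pab: "p (a, b) \<noteq> 0" using abS S(2) by (auto simp: p_def)
  have "0 = (\<Sum>q\<in>S. fps_const (p q) * mon q)"
    using assms(2) S(3)[of z w] by (simp add: p_def mon_def case_prod_unfold mult.assoc)
  also have "\<dots> = fps_const (p (a, b)) * mon (a, b) + (\<Sum>q\<in>S - {(a, b)}. fps_const (p q) * mon q)"
    using S(1) abS(1) by (rule sum.remove)
  finally have "fps_const (p (a, b)) * mon (a, b) = - (\<Sum>q\<in>S - {(a, b)}. fps_const (p q) * mon q)"
    by (simp add: eq_neg_iff_add_eq_0)
  then have "fps_const (inverse (p (a, b))) * (fps_const (p (a, b)) * mon (a, b)) =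
      fps_const (inverse (p (a, b))) * - (\<Sum>q\<in>S - {(a, b)}. fps_const (p q) * mon q)"
    by simp
  moreover have "fps_const (inverse (p (a, b))) * (fps_const (p (a, b)) * mon (a, b)) = mon (a, b)"
    using pab by (simp add: mult.assoc[symmetric])
  ultimately have mab: "mon (a, b) =
      fps_const (inverse (p (a, b))) * - (\<Sum>q\<in>S - {(a, b)}. fps_const (p q) * mon q)"
    by simp
  have reduce: "mon q \<in> cfps.span (mon ` Red N)" if "fst q + snd q \<le> N" for q N
    using that
  \<comment> \<open>Well-founded induction along the graded order itself: one division step replaces
    a monomial by smaller ones, whose total degree still is at most \<open>N\<close>.\<close>
  proof (induction q rule: wf_induct[OF wf_measures[of "[\<lambda>q. fst q + snd q, fst]"]])
    case (1 q)
    obtain i j where q: "q = (i, j)" by (cases q)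
    show ?case
    proof (cases "a \<le> i \<and> b \<le> j")
      case False
      then show ?thesis using 1 q by (intro cfps.span_base) (auto simp: Red_def)
    next
      case True
      have mq: "mon q = mon (i - a, j - b) * mon (a, b)"
      proof -
        have "z ^ i = z ^ (i - a) * z ^ a" "w ^ j = w ^ (j - b) * w ^ b"
          using True by (simp_all add: power_add[symmetric])
        then show ?thesis by (simp add: q mon_def mult_ac)
      qed
      have mq': "mon q = fps_const (- inverse (p (a, b))) *
          (\<Sum>(k, l)\<in>S - {(a, b)}. fps_const (p (k, l)) * mon (i - a + k, j - b + l))"
        unfolding mq mab sum_distrib_left mult_minus_right sum_negf[symmetric]
        by (intro sum.cong) (auto simp: mon_def power_add mult_ac
            fps_const_neg[symmetric] simp del: fps_const_neg)
      moreover have "mon (i - a + k, j - b + l) \<in> cfps.span (mon ` Red N)"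
        if "(k, l) \<in> S - {(a, b)}" for k l
      proof -
        have "((i - a + k, j - b + l), q) \<in> measures [\<lambda>q. fst q + snd q, fst]"
          and "fst (i - a + k, j - b + l) + snd (i - a + k, j - b + l) \<le> N"
          using lead[OF that] 1(2) True by (auto simp: q)
        then show ?thesis using 1(1) by blast
      qed
      ultimately show ?thesis
        unfolding mq' by (intro cfps.span_scale cfps.span_sum) (auto intro!: cfps.span_scale)
    qed
  qed
  have card: "finite (Red N) \<and> card (Red N) \<le> (a + b) * (N + 1)" for N
  proof -
    \<comment> \<open>Two strips, of width \<open>a\<close> and \<open>b\<close>: this makes the
      count linear in \<open>N\<close>, with the total degree of \<open>P\<close> as factor.\<close>
    have sub: "Red N \<subseteq> {..<a} \<times> {..N} \<union> {..N} \<times> {..<b}" by (auto simp: Red_def)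
    have "card (Red N) \<le> card ({..<a} \<times> {..N} \<union> {..N} \<times> {..<b})"
      by (rule card_mono) (use sub in auto)
    also have "\<dots> \<le> card ({..<a} \<times> {..N}) + card ({..N} \<times> {..<b})" by (rule card_Un_le)
    also have "\<dots> = (a + b) * (N + 1)" by (simp add: algebra_simps)
    finally show ?thesis using finite_subset[OF sub] by auto
  qed
  show ?thesis
  proof
    fix N
    show "\<exists>T. finite T \<and> card T \<le> (a + b) * (N + 1) \<and> poly_span z w N \<subseteq> cfps.span T"
    proof (intro exI conjI)
      show "finite (mon ` Red N)" using card by blast
      show "card (mon ` Red N) \<le> (a + b) * (N + 1)"
        using card card_image_le order_trans by blast
      show "poly_span z w N \<subseteq> cfps.span (mon ` Red N)"
        unfolding poly_span_def mon_def[symmetric]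
        by (rule cfps.span_minimal) (use reduce in auto)
    qed
  qed
qed

text \<open>
  The monomials \<open>x ^ i * y ^ j\<close> with \<open>i, j \<le> n\<close> become, after multiplication by
  \<open>B ^ (2 * n)\<close>, about \<open>n\<^sup>2\<close> elements of a space of dimension \<open>O(n)\<close>.
\<close>

lemma rational_functions_on_curve_dependent:
  assumes "P \<noteq> 0" "eval2 P z w = 0"
    and "B \<noteq> 0" "B \<in> poly_values z w" "x * B \<in> poly_values z w" "y * B \<in> poly_values z w"
  obtains n :: nat and c :: "nat \<times> nat \<Rightarrow> complex" where
    "\<exists>q\<in>{..n} \<times> {..n}. c q \<noteq> 0" "(\<Sum>(i, j)\<in>{..n} \<times> {..n}. fps_const (c (i, j)) * x ^ i * y ^ j) = 0"
proof -
  obtain d where d: "\<And>N. \<exists>T. finite T \<and> card T \<le> d * (N + 1) \<and> poly_span z w N \<subseteq> cfps.span T"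
    using poly_span_dimension_linear[OF assms(1,2)] by blast
  obtain e1 e2 e3 where e123: "B \<in> poly_span z w e1" "x * B \<in> poly_span z w e2" "y * B \<in> poly_span z w e3"
    using assms(4-6) unfolding poly_values_def by blast
  define e where "e = e1 + e2 + e3"
  have e: "B \<in> poly_span z w e" "x * B \<in> poly_span z w e" "y * B \<in> poly_span z w e"
    using e123 poly_span_mono[of _ e z w] unfolding e_def by (metis le_add1 le_add2 subsetD trans_le_add1)+
  \<comment> \<open>Chosen so that d (2ne + 1) \<le> d (2e + 1)(n + 1) = n (n + 1), which is less
    than the number (n + 1)^2 of monomials.\<close>
  define n where "n = d * (2 * e + 1)"
  define v where "v = (\<lambda>(i, j). x ^ i * y ^ j * B ^ (2 * n))"
  have v: "v q \<in> poly_span z w (2 * n * e)" if "q \<in> {..n} \<times> {..n}" for q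
  proof -
    obtain i j where q: "q = (i, j)" "i \<le> n" "j \<le> n" using \<open>q \<in> _\<close> by auto
    \<comment> \<open>One factor \<open>B\<close> for each of the i + j \<le> 2n factors
      \<open>x\<close> and \<open>y\<close>; the remaining powers of \<open>B\<close> are elements
      of the algebra anyway.\<close>
    have "2 * n = i + (j + (2 * n - i - j))" using q by simp
    then have "B ^ (2 * n) = B ^ i * (B ^ j * B ^ (2 * n - i - j))" by (metis power_add)
    then have "v q = (x * B) ^ i * ((y * B) ^ j * B ^ (2 * n - i - j))"
      by (simp add: v_def q power_mult_distrib mult_ac)
    moreover have "\<dots> \<in> poly_span z w (i * e + (j * e + (2 * n - i - j) * e))"
      by (intro poly_span_mult poly_span_power e)
    moreover have "i * e + (j * e + (2 * n - i - j) * e) = 2 * n * e"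
    proof -
      have "i * e + (j * e + (2 * n - i - j) * e) = (i + (j + (2 * n - i - j))) * e"
        by (simp only: ring_distribs)
      then show ?thesis using \<open>2 * n = _\<close> by metis
    qed
    ultimately show ?thesis by metis
  qed
  obtain T where T: "finite T" "card T \<le> d * (2 * n * e + 1)" "poly_span z w (2 * n * e) \<subseteq> cfps.span T"
    using d by blast
  have "d * (2 * n * e + 1) \<le> d * ((2 * e + 1) * (n + 1))"
    by (intro mult_le_mono2) (simp add: algebra_simps)
  also have "\<dots> = n * (n + 1)" unfolding n_def by (simp only: mult.assoc)
  also have "\<dots> < card ({..n} \<times> {..n})" by simp
  finally have "card T < card ({..n} \<times> {..n})" using T(2) by linarith
  then obtain c where c: "\<exists>q\<in>{..n} \<times> {..n}. c q \<noteq> 0" "(\<Sum>q\<in>{..n} \<times> {..n}. fps_const (c q) * v q) = 0"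
    using relation_of_span_card[of "{..n} \<times> {..n}" T v] T v by blast
  have "(\<Sum>q\<in>{..n} \<times> {..n}. fps_const (c q) * v q) =
      (\<Sum>(i, j)\<in>{..n} \<times> {..n}. fps_const (c (i, j)) * x ^ i * y ^ j) * B ^ (2 * n)"
    unfolding sum_distrib_right by (intro sum.cong) (auto simp: v_def mult_ac)
  then have "(\<Sum>(i, j)\<in>{..n} \<times> {..n}. fps_const (c (i, j)) * x ^ i * y ^ j) = 0"
    using c(2) assms(3) by simp
  then show ?thesis using that c(1) by blast
qed

text \<open>What the curve yields as rational functions are powers, such as s^(2M) and f^(2M), and a
  relation between powers of \<open>x\<close> and \<open>y\<close> is a relation between
  \<open>x\<close> and \<open>y\<close>.\<close>

lemma rational_functions_on_curve_algebraic:
  assumes "P \<noteq> 0" "eval2 P z w = 0"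
    and "B \<noteq> 0" "B \<in> poly_values z w" "x ^ m * B \<in> poly_values z w" "y ^ n * B \<in> poly_values z w"
    and "m > 0" "n > 0"
  shows "\<exists>R. R \<noteq> 0 \<and> eval2 R x y = 0"
proof -
  obtain N c where "\<exists>q\<in>{..N} \<times> {..N}. c q \<noteq> 0"
    "(\<Sum>(i, j)\<in>{..N} \<times> {..N}. fps_const (c (i, j)) * (x ^ m) ^ i * (y ^ n) ^ j) = 0"
    using rational_functions_on_curve_dependent[OF assms(1-6)] by blast
  then show ?thesis
    using eval2_relation_of_sum[of "{..N} \<times> {..N}" _ _ c m n x y] assms(7,8) by auto
qed

section \<open>Algebraic relations forced by the differential equation\<close>

text \<open>Descent on the degree: differentiating q(z) = 0 gives q'(z) z' = 0, and z' can be
  cancelled.\<close>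

lemma nonconstant_fps_transcendental:
  assumes "fps_deriv z \<noteq> 0" "poly (map_poly fps_const q) z = 0"
  shows "q = (0 :: complex poly)"
  using assms(2)
proof (induction "degree q" arbitrary: q rule: less_induct)
  case less
  have "poly (map_poly fps_const (pderiv q)) z * fps_deriv z = 0"
    using less.prems fps_deriv_poly_fps_const[of q z] by simp
  then have *: "poly (map_poly fps_const (pderiv q)) z = 0" using assms(1) by simp
  show ?case
  proof (cases "degree q = 0")
    case True
    then obtain a where "q = [:a:]" by (auto elim: degree_eq_zeroE)
    then show ?thesis using less.prems by (simp add: poly_fps_const_pCons)
  next
    case False
    then have "pderiv q = 0" using less.hyps[OF _ *] degree_pderiv[of q] by auto
    then show ?thesis using False by (simp add: pderiv_eq_0_iff)
  qed
qed

text \<open>Differentiate in the second variable as long as the derivative still vanishes on the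
  curve. The degree drops each time, and degree 0 cannot be reached, because it would be a
  polynomial relation for the nonconstant \<open>z\<close> alone.\<close>

lemma minimal_relation:
  assumes "P \<noteq> 0" "eval2 P z w = 0" "fps_deriv z \<noteq> 0"
  obtains Q where "Q \<noteq> 0" "eval2 Q z w = 0" "eval2 (pderiv Q) z w \<noteq> 0"
proof -
  have "\<exists>Q. Q \<noteq> 0 \<and> eval2 Q z w = 0 \<and> eval2 (pderiv Q) z w \<noteq> 0"
    using assms(1,2)
  proof (induction "degree P" arbitrary: P rule: less_induct)
    case less
    show ?case
    proof (cases "degree P = 0")
      case True
      then obtain a where "P = [:a:]" by (auto elim: degree_eq_zeroE)
      then show ?thesis
        using less.prems nonconstant_fps_transcendental[OF assms(3), of a] by simp
    next
      case False
      then show ?thesis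
        using less.hyps[of "pderiv P"] less.prems degree_pderiv[of P]
        by (cases "eval2 (pderiv P) z w = 0") (auto simp: pderiv_eq_0_iff)
    qed
  qed
  then show ?thesis using that by blast
qed

text \<open>Here \<open>E\<close> stands for the series of f, and the differential equation makes S
  = s^(2M) a rational function on the curve. The relation for \<open>w\<close> pairs it with S, the
  one for \<open>E\<close> pairs E^(2M) with S.\<close>

lemma relations_from_parametrized_curve:
  fixes z w E :: "complex fps" and c :: complex and M :: nat
  defines "z \<equiv> fps_const c * (fps_X * E) ^ M"
  assumes "M \<ge> 1" "c \<noteq> 0" "E \<noteq> 0" "P \<noteq> 0" "eval2 P z w = 0"
    and w': "fps_deriv w * z = fps_const (2 * \<i>) * fps_X ^ (2 * M) * fps_deriv z"
  shows "\<exists>R. R \<noteq> 0 \<and> eval2 R fps_X w = 0" and "\<exists>R. R \<noteq> 0 \<and> eval2 R fps_X E = 0"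
proof -
  have "z $ 0 = 0" using assms(2) by (simp add: z_def fps_power_zeroth)
  moreover have "z \<noteq> 0" using assms by (simp add: z_def)
  ultimately have z': "fps_deriv z \<noteq> 0"
    by (metis fps_const_0_eq_0 fps_deriv_eq_0_iff)
  obtain Q where Q: "Q \<noteq> 0" "eval2 Q z w = 0" "eval2 (pderiv Q) z w \<noteq> 0"
    using minimal_relation[OF assms(5,6) z'] by blast
  define S :: "complex fps" where "S = fps_X ^ (2 * M)"
  define A where "A = eval2 (map_poly pderiv Q) z w"
  \<comment> \<open>The denominator of S: the differentiated relation becomes
    \<open>A * z + S * B = 0\<close>.\<close>
  define B where "B = fps_const (2 * \<i>) * eval2 (pderiv Q) z w"
  have "0 = fps_deriv (eval2 Q z w) * z" using Q(2) by simp
  also have "\<dots> = A * fps_deriv z * z + eval2 (pderiv Q) z w * (fps_deriv w * z)"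
    by (simp add: eval2_deriv A_def algebra_simps)
  also have "\<dots> = fps_deriv z * (A * z + S * B)"
    unfolding w' by (simp add: B_def S_def algebra_simps)
  finally have "A * z + S * B = 0" using z' by simp
  then have SB: "S * B = fps_const (- 1) * (A * z)"
    by (simp add: add_eq_0_iff)
  have B: "B \<noteq> 0" "B \<in> poly_values z w"
    unfolding B_def using Q(3) by (auto intro!: poly_values_mult poly_values_const eval2_in_poly_values)
  have SBv: "S * B \<in> poly_values z w"
    unfolding SB A_def
    by (intro poly_values_mult poly_values_const eval2_in_poly_values poly_values_fst)
  show "\<exists>R. R \<noteq> 0 \<and> eval2 R fps_X w = 0"
    using rational_functions_on_curve_algebraic[OF Q(1,2) B, of fps_X "2 * M" w 1] SBv assms(2)
      poly_values_mult[OF poly_values_snd B(2)] by (auto simp: S_def)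
  \<comment> \<open>A common denominator of S and E^(2M) = z^2 / (c^2 S). As S is itself a quotient
    with denominator \<open>B\<close>, the factor c^2 S enters as
    \<open>fps_const (c\<^sup>2) * (S * B)\<close>.\<close>
  define B' where "B' = B * (fps_const (c\<^sup>2) * (S * B))"
  have z2: "z * z = fps_const (c\<^sup>2) * S * E ^ (2 * M)"
  proof -
    have "fps_const (c\<^sup>2) = fps_const c * fps_const c" by (simp add: power2_eq_square)
    moreover have "S * E ^ (2 * M) = (fps_X * E) ^ M * (fps_X * E) ^ M"
      unfolding S_def by (simp only: power_mult_distrib mult_2 power_add) (simp only: mult_ac)
    moreover have "z * z = fps_const c * fps_const c * ((fps_X * E) ^ M * (fps_X * E) ^ M)"
      by (simp only: z_def mult_ac)
    ultimately show ?thesis by (simp only: mult.assoc)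
  qed
  have "B' \<noteq> 0" using B assms(3) by (simp add: B'_def S_def)
  moreover have B'v: "B' \<in> poly_values z w"
    unfolding B'_def by (intro poly_values_mult B SBv poly_values_const)
  moreover have "fps_X ^ (2 * M) * B' \<in> poly_values z w"
  proof -
    have "fps_X ^ (2 * M) * B' = (S * B) * (fps_const (c\<^sup>2) * (S * B))"
      by (simp add: B'_def S_def mult_ac)
    then show ?thesis by (simp only:) (intro poly_values_mult SBv poly_values_const)
  qed
  moreover have "E ^ (2 * M) * B' \<in> poly_values z w"
  proof -
    have "E ^ (2 * M) * B' = (fps_const (c\<^sup>2) * S * E ^ (2 * M)) * (B * B)"
      by (simp add: B'_def mult_ac)
    then show ?thesis
      unfolding z2[symmetric] by (simp only:) (intro poly_values_mult B poly_values_fst)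
  qed
  ultimately show "\<exists>R. R \<noteq> 0 \<and> eval2 R fps_X E = 0"
    using rational_functions_on_curve_algebraic[OF Q(1,2), of B' fps_X "2 * M" E "2 * M"] assms(2)
    by auto
qed

section \<open>Germs with an algebraic primitive\<close>

lemma eval_bipoly_0 [simp]: "eval_bipoly 0 x y = 0"
  by (simp add: eval_bipoly_def)

lemma eval_bipoly_pCons [simp]:
  "eval_bipoly (pCons q P) x y = poly q x + y * eval_bipoly P x y"
  by (simp add: eval_bipoly_def map_poly_pCons)

lemma has_fps_expansion_eval_bipoly:
  assumes "z has_fps_expansion Z" "w has_fps_expansion W"
  shows "(\<lambda>s. eval_bipoly P (z s) (w s)) has_fps_expansion eval2 P Z W"
proof (induction P)
  case (pCons q P)
  have "(\<lambda>s. poly q (z s)) has_fps_expansion poly (map_poly fps_const q) Z"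
    by (induction q) (auto simp: poly_fps_const_pCons intro!: fps_expansion_intros assms)
  with pCons.IH show ?case
    by (auto intro!: fps_expansion_intros assms)
qed auto

lemma holomorphic_on_eval_bipoly [holomorphic_intros]:
  assumes "f holomorphic_on S" "g holomorphic_on S"
  shows "(\<lambda>t. eval_bipoly P (f t) (g t)) holomorphic_on S"
proof (induction P)
  case (pCons q P)
  have "(\<lambda>t. poly q (f t)) holomorphic_on S"
    by (induction q) (auto intro!: holomorphic_intros assms)
  with pCons.IH show ?case
    by (auto intro!: holomorphic_intros assms)
qed auto

text \<open>The primitive is bound inside, so the property depends only on the germ of
  \<open>h\<close> and is insensitive to the constant of integration. The map \<sigma> records the
  point of the base plane, since forms are later pulled back to other variables while
  \<open>R\<close> stays the same.\<close>

definition algebraic_primitive ::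
  "complex poly poly \<Rightarrow> (complex \<Rightarrow> complex) \<Rightarrow> (complex \<Rightarrow> complex) \<Rightarrow> complex \<Rightarrow> bool" where
  "algebraic_primitive R \<sigma> h b \<longleftrightarrow>
     (\<exists>W. \<forall>\<^sub>F t in nhds b. (W has_field_derivative h t) (at t) \<and> eval_bipoly R (\<sigma> t) (W t) = 0)"

lemma algebraic_primitive_cong:
  assumes "\<forall>\<^sub>F t in nhds b. h t = h' t" "algebraic_primitive R \<sigma> h b"
  shows "algebraic_primitive R \<sigma> h' b"
proof -
  obtain W where "\<forall>\<^sub>F t in nhds b. (W has_field_derivative h t) (at t) \<and> eval_bipoly R (\<sigma> t) (W t) = 0"
    using assms(2) unfolding algebraic_primitive_def by blast
  with assms(1) have
    "\<forall>\<^sub>F t in nhds b. (W has_field_derivative h' t) (at t) \<and> eval_bipoly R (\<sigma> t) (W t) = 0"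
    by eventually_elim auto
  then show ?thesis unfolding algebraic_primitive_def by blast
qed

text \<open>The local primitive differs from \<open>H\<close> by a constant near \<open>b\<close>,
  and the identity theorem spreads the relation over the connected set.\<close>

lemma algebraic_primitive_extends:
  assumes S: "open S" "connected S" and "\<sigma> holomorphic_on S" "b \<in> S"
    and H: "\<And>t. t \<in> S \<Longrightarrow> (H has_field_derivative h t) (at t)"
    and "algebraic_primitive R \<sigma> h b"
  obtains C where "\<And>t. t \<in> S \<Longrightarrow> eval_bipoly R (\<sigma> t) (H t + C) = 0"
proof -
  obtain W where "\<forall>\<^sub>F t in nhds b. (W has_field_derivative h t) (at t) \<and> eval_bipoly R (\<sigma> t) (W t) = 0"
    using assms(6) unfolding algebraic_primitive_def by blast
  then obtain U where U: "open U" "b \<in> U"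
    "\<And>t. t \<in> U \<Longrightarrow> (W has_field_derivative h t) (at t) \<and> eval_bipoly R (\<sigma> t) (W t) = 0"
    unfolding eventually_nhds by blast
  have "open (U \<inter> S)" "b \<in> U \<inter> S" using U S assms(4) by auto
  then obtain e where e: "e > 0" "ball b e \<subseteq> U \<inter> S"
    by (meson openE)
  have "\<exists>C. \<forall>t\<in>ball b e. W t - H t = C"
  proof (rule has_field_derivative_zero_constant)
    fix t assume "t \<in> ball b e"
    then have "t \<in> U" "t \<in> S" using e(2) by auto
    then have "(W has_field_derivative h t) (at t within ball b e)"
      "(H has_field_derivative h t) (at t within ball b e)"
      using U(3) H by (blast intro: has_field_derivative_at_within)+
    from DERIV_diff[OF this] show "((\<lambda>t. W t - H t) has_field_derivative 0) (at t within ball b e)"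
      by simp
  qed auto
  then obtain C where C: "\<And>t. t \<in> ball b e \<Longrightarrow> W t = H t + C"
    by (auto simp: algebra_simps)
  have "H holomorphic_on S"
    using H S(1) by (auto simp: holomorphic_on_open)
  show ?thesis
  proof
    fix t assume "t \<in> S"
    show "eval_bipoly R (\<sigma> t) (H t + C) = 0"
    proof (rule analytic_continuation_open[of "ball b e" S
          "\<lambda>t. eval_bipoly R (\<sigma> t) (H t + C)" "\<lambda>_. 0"])
      show "(\<lambda>t. eval_bipoly R (\<sigma> t) (H t + C)) holomorphic_on S"
        by (intro holomorphic_intros assms \<open>H holomorphic_on S\<close>)
      show "eval_bipoly R (\<sigma> t) (H t + C) = 0" if "t \<in> ball b e" for t
        using C[OF that] U(3)[of t] that e(2) by auto
    qed (use e S \<open>t \<in> S\<close> in auto)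
  qed
qed

text \<open>A primitive on all of \<open>S\<close> may fail to exist, as on a punctured disc, but
  every small disc has one. The induction chains such discs, and the constants may change from one
  disc to the next.\<close>

lemma algebraic_primitive_connected:
  assumes S: "open S" "connected S" and "\<sigma> holomorphic_on S" "h holomorphic_on S"
    and "b \<in> S" "b' \<in> S" "algebraic_primitive R \<sigma> h b"
  shows "algebraic_primitive R \<sigma> h b'"
proof (rule connected_induction_simple[OF S(2) assms(5,6), where P = "algebraic_primitive R \<sigma> h"])
  fix a assume "a \<in> S"
  then obtain e where e: "e > 0" "ball a e \<subseteq> S" using S(1) openE by blast
  have "h holomorphic_on ball a e" "\<sigma> holomorphic_on ball a e"
    using assms(3,4) e holomorphic_on_subset by blast+
  obtain H where H: "\<And>x. x \<in> ball a e \<Longrightarrow> (H has_field_derivative h x) (at x within ball a e)"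
    using holomorphic_convex_primitive'[OF _ _ \<open>h holomorphic_on ball a e\<close>] by auto
  then have H': "(H has_field_derivative h x) (at x)" if "x \<in> ball a e" for x
    using that by (metis at_within_open open_ball)
  have "algebraic_primitive R \<sigma> h y"
    if xy: "x \<in> ball a e" "y \<in> ball a e" and alg: "algebraic_primitive R \<sigma> h x" for x y
  proof -
    obtain C where C: "\<And>t. t \<in> ball a e \<Longrightarrow> eval_bipoly R (\<sigma> t) (H t + C) = 0"
      using algebraic_primitive_extends[OF _ _ \<open>\<sigma> holomorphic_on ball a e\<close> xy(1) H' alg]
      by auto
    have "\<forall>\<^sub>F t in nhds y. t \<in> ball a e"
      using xy(2) by (intro eventually_nhds_in_open) auto
    then show ?thesis
      unfolding algebraic_primitive_def
      by (intro exI[of _ "\<lambda>t. H t + C"])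
        (auto elim!: eventually_mono intro!: derivative_eq_intros H' C)
  qed
  then show "\<exists>T. openin (top_of_set S) T \<and> a \<in> T \<and>
      (\<forall>x\<in>T. \<forall>y\<in>T. algebraic_primitive R \<sigma> h x \<longrightarrow> algebraic_primitive R \<sigma> h y)"
  proof (intro exI conjI)
    show "openin (top_of_set S) (ball a e)" using e(2) by (simp add: open_subset)
    show "a \<in> ball a e" using e(1) by simp
  qed blast
qed (use assms in auto)

lemma eventually_nhds_analytic_at:
  assumes "f analytic_on {z}"
  shows "\<forall>\<^sub>F w in nhds z. f analytic_on {w}"
proof -
  obtain U where "open U" "z \<in> U" "f holomorphic_on U"
    using assms analytic_at by blast
  then show ?thesis
    unfolding eventually_nhds analytic_at by blast
qed

text \<open>Substitution rule: the form h ds pulled back by s = \<phi>(\<tau>) has the primitive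
  \<open>W \<circ> \<phi>\<close>.\<close>

lemma algebraic_primitive_compose:
  assumes "\<phi> analytic_on {t}" "algebraic_primitive R \<sigma> h (\<phi> t)"
  shows "algebraic_primitive R (\<sigma> \<circ> \<phi>) (\<lambda>\<tau>. h (\<phi> \<tau>) * deriv \<phi> \<tau>) t"
proof -
  obtain W where W: "\<forall>\<^sub>F s in nhds (\<phi> t). (W has_field_derivative h s) (at s) \<and> eval_bipoly R (\<sigma> s) (W s) = 0"
    using assms(2) unfolding algebraic_primitive_def by blast
  have "isCont \<phi> t"
    using assms(1) analytic_at_imp_isCont by blast
  then have "filterlim \<phi> (nhds (\<phi> t)) (nhds t)"
    by (simp add: isCont_def tendsto_at_iff_tendsto_nhds)
  from eventually_compose_filterlim[OF W this] have
    "\<forall>\<^sub>F \<tau> in nhds t. (W has_field_derivative h (\<phi> \<tau>)) (at (\<phi> \<tau>)) \<and> eval_bipoly R (\<sigma> (\<phi> \<tau>)) (W (\<phi> \<tau>)) = 0" .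
  moreover have "\<forall>\<^sub>F \<tau> in nhds t. \<phi> analytic_on {\<tau>}"
    using assms(1) by (rule eventually_nhds_analytic_at)
  ultimately have "\<forall>\<^sub>F \<tau> in nhds t. (W \<circ> \<phi> has_field_derivative h (\<phi> \<tau>) * deriv \<phi> \<tau>) (at \<tau>) \<and>
      eval_bipoly R ((\<sigma> \<circ> \<phi>) \<tau>) ((W \<circ> \<phi>) \<tau>) = 0"
  proof eventually_elim
    case (elim \<tau>)
    then have "(\<phi> has_field_derivative deriv \<phi> \<tau>) (at \<tau>)"
      by (simp add: analytic_derivI)
    with elim show ?case by (auto intro: DERIV_chain)
  qed
  then show ?thesis unfolding algebraic_primitive_def by blast
qed

section \<open>Transport of a property of germs along a path\<close>

lemma eventually_at_imp_eventually_nhds: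
  fixes a :: "'a::t1_space"
  assumes "\<forall>\<^sub>F z in at a. P z"
  shows "\<forall>\<^sub>F z in at a. \<forall>\<^sub>F y in nhds z. P y"
proof -
  obtain U where U: "open U" "a \<in> U" "\<And>z. z \<in> U \<Longrightarrow> z \<noteq> a \<Longrightarrow> P z"
    using assms unfolding eventually_at_topological by blast
  have "open (U - {a})" using U(1) by (simp add: open_delete)
  then have "\<forall>\<^sub>F y in nhds z. P y" if "z \<in> U" "z \<noteq> a" for z
    using U(3) that unfolding eventually_nhds by (intro exI[of _ "U - {a}"]) auto
  then show ?thesis using U unfolding eventually_at_topological by blast
qed

text \<open>
  The germs may have isolated singularities on the path because \<open>f' / f\<close> has poles at the zeros
  of the continuations of \<open>f\<close>.
\<close>

lemma property_transported_along_path: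
  fixes h :: "real \<Rightarrow> complex \<Rightarrow> complex"
  assumes "path p"
    and hol: "\<And>t. t \<in> {0..1} \<Longrightarrow> \<exists>e>0. h t holomorphic_on (ball (p t) e - {p t})"
    and cont: "\<And>t. t \<in> {0..1} \<Longrightarrow>
       \<exists>e>0. \<forall>u\<in>{0..1}. \<bar>u - t\<bar> < e \<longrightarrow> (\<forall>\<^sub>F z in at (p u). h u z = h t z)"
    and Qcong: "\<And>f g z. \<forall>\<^sub>F y in nhds z. f y = g y \<Longrightarrow> Q f z \<Longrightarrow> Q g z"
    and Qconn: "\<And>f S a b. open S \<Longrightarrow> connected S \<Longrightarrow> f holomorphic_on S \<Longrightarrow>
       a \<in> S \<Longrightarrow> b \<in> S \<Longrightarrow> Q f a \<Longrightarrow> Q f b"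
    and "\<forall>\<^sub>F z in at (p 0). Q (h 0) z" "t \<in> {0..1}"
  shows "\<forall>\<^sub>F z in at (p t). Q (h t) z"
proof (rule connected_induction_simple[of "{0..1::real}" 0 t "\<lambda>t. \<forall>\<^sub>F z in at (p t). Q (h t) z"])
  fix t :: real assume t: "t \<in> {0..1}"
  obtain e1 where e1: "e1 > 0" "h t holomorphic_on (ball (p t) e1 - {p t})"
    using hol[OF t] by blast
  obtain e2 where e2: "e2 > 0"
    "\<And>u. u \<in> {0..1} \<Longrightarrow> \<bar>u - t\<bar> < e2 \<Longrightarrow> (\<forall>\<^sub>F z in at (p u). h u z = h t z)"
    using cont[OF t] by blast
  have "continuous_on {0..1} p" using \<open>path p\<close> by (simp add: path_def)
  then obtain d where d: "d > 0" "\<And>u. u \<in> {0..1} \<Longrightarrow> dist u t < d \<Longrightarrow> dist (p u) (p t) < e1"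
    using t e1(1) unfolding continuous_on_iff by metis
  define B where "B = ball (p t) e1 - {p t}"
  have B: "open B" "connected B" "h t holomorphic_on B"
    using e1 by (auto simp: B_def intro!: open_delete connected_punctured_ball)
  define T where "T = {0..1} \<inter> ball t (min e2 d)"
  have near: "\<forall>\<^sub>F z in at (p u). z \<in> B \<and> (\<forall>\<^sub>F y in nhds z. h u y = h t y)" if "u \<in> T" for u
  proof -
    have u: "u \<in> {0..1}" "\<bar>u - t\<bar> < e2" "dist (p u) (p t) < e1"
      using that d(2) by (auto simp: T_def dist_real_def abs_minus_commute)
    have "\<forall>\<^sub>F z in at (p u). z \<in> ball (p t) e1"
      using u(3) by (intro eventually_at_in_open') (auto simp: dist_commute)
    moreover have "\<forall>\<^sub>F z in at (p u). z \<noteq> p t"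
      by (rule eventually_neq_at_within)
    ultimately show ?thesis
      using eventually_at_imp_eventually_nhds[OF e2(2)[OF u(1,2)]]
      by eventually_elim (auto simp: B_def)
  qed
  \<comment> \<open>For all parameters \<open>u\<close> in \<open>T\<close> the local property is
    equivalent to one and the same statement about \<open>h t\<close> on the punctured disc
    \<open>B\<close>: connectedness of \<open>B\<close> gives one direction, agreement of the germs
    the other. This lets the property pass between any two parameters in \<open>T\<close>.\<close>
  have iff: "(\<forall>\<^sub>F z in at (p u). Q (h u) z) \<longleftrightarrow> (\<forall>z\<in>B. Q (h t) z)" if "u \<in> T" for u
  proof
    assume "\<forall>\<^sub>F z in at (p u). Q (h u) z"
    with near[OF that] have "\<forall>\<^sub>F z in at (p u). z \<in> B \<and> Q (h t) z"
      by eventually_elim (use Qcong in blast)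
    then obtain z where "z \<in> B" "Q (h t) z"
      using eventually_happens'[OF at_neq_bot] by blast
    then show "\<forall>z\<in>B. Q (h t) z" using Qconn[OF B] by blast
  next
    assume *: "\<forall>z\<in>B. Q (h t) z"
    from near[OF that] show "\<forall>\<^sub>F z in at (p u). Q (h u) z"
    proof eventually_elim
      case (elim z)
      then have "\<forall>\<^sub>F y in nhds z. h t y = h u y"
        by (auto elim: eventually_mono)
      then show ?case using Qcong * elim by blast
    qed
  qed
  show "\<exists>T. openin (top_of_set {0..1}) T \<and> t \<in> T \<and> (\<forall>x\<in>T. \<forall>y\<in>T.
      (\<forall>\<^sub>F z in at (p x). Q (h x) z) \<longrightarrow> (\<forall>\<^sub>F z in at (p y). Q (h y) z))"
  proof (intro exI conjI ballI impI)
    show "openin (top_of_set {0..1}) T" unfolding T_def by (simp add: openin_open_Int)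
    show "t \<in> T" using t e2(1) d(1) by (simp add: T_def)
  qed (use iff in blast)
qed (use assms in auto)

section \<open>Vanishing of residues of forms with an algebraic primitive\<close>

text \<open>One period of the cover \<open>exp\<close> is one positive turn around 0, which turns
  the period of a primitive into a residue.\<close>

lemma linepath_exp_eq_circlepath:
  assumes "r > 0"
  shows "exp \<circ> linepath (of_real (ln r)) (of_real (ln r) + 2 * of_real pi * \<i>) = circlepath 0 r"
proof
  fix x :: real
  have "linepath (of_real (ln r)) (of_real (ln r) + 2 * of_real pi * \<i>) x =
      of_real (ln r) + 2 * of_real pi * \<i> * of_real x"
    by (simp add: linepath_def scaleR_conv_of_real algebra_simps)
  then show "(exp \<circ> linepath (of_real (ln r)) (of_real (ln r) + 2 * of_real pi * \<i>)) x = circlepath 0 r x"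
    using assms by (simp add: circlepath exp_add exp_of_real)
qed

text \<open>
  On the universal cover \<open>exp\<close> of the punctured disc a primitive \<open>W\<close> of the pull-back of \<open>h\<close>
  exists, and each of the values \<open>W + m * 2 \<pi> \<i> * residue h 0\<close> is a root of the same polynomial.
\<close>

lemma algebraic_primitive_imp_residue_0:
  assumes "r > 0" "h holomorphic_on (ball 0 r - {0})" "\<sigma> holomorphic_on (ball 0 r - {0})"
    and b: "b \<in> ball 0 r - {0}" "algebraic_primitive R \<sigma> h b"
    and "R \<noteq> 0" "infinite (\<sigma> ` (ball 0 r - {0}))"
  shows "residue h 0 = 0"
proof (rule ccontr)
  assume res: "residue h 0 \<noteq> 0"
  \<comment> \<open>The half-plane that \<open>exp\<close> maps onto the punctured disc. It is
    convex, so the pulled-back form has a primitive there.\<close>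
  define S where "S = {u. Re u < ln r}"
  have S: "open S" "convex S" "connected S"
    by (auto simp: S_def open_halfspace_Re_lt convex_halfspace_Re_lt intro: convex_connected)
  have exp_S: "exp u \<in> ball 0 r - {0}" if "u \<in> S" for u
    using that assms(1) by (auto simp: S_def norm_exp_eq_Re) (metis exp_less_cancel_iff exp_ln)
  have Ln_S: "Ln t \<in> S" "exp (Ln t) = t" if "t \<in> ball 0 r - {0}" for t
    using that assms(1) by (auto simp: S_def)
  define g where "g = (\<lambda>u. h (exp u) * exp u)"
  have "exp ` S \<subseteq> ball 0 r - {0}" using exp_S by (rule image_subsetI)
  then have "(h \<circ> exp) holomorphic_on S" "(\<sigma> \<circ> exp) holomorphic_on S"
    using holomorphic_on_compose_gen[OF holomorphic_on_exp assms(2)]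
      holomorphic_on_compose_gen[OF holomorphic_on_exp assms(3)] by simp_all
  then have g: "g holomorphic_on S" and \<sigma>e: "(\<sigma> \<circ> exp) holomorphic_on S"
    unfolding g_def by (auto simp: o_def intro!: holomorphic_intros)
  obtain H where H0: "\<And>x. x \<in> S \<Longrightarrow> (H has_field_derivative g x) (at x within S)"
    using holomorphic_convex_primitive'[OF S(2,1) g] by blast
  then have H: "(H has_field_derivative g x) (at x)" if "x \<in> S" for x
    using that S(1) by (metis at_within_open)
  have "algebraic_primitive R (\<sigma> \<circ> exp) (\<lambda>u. h (exp u) * deriv exp u) (Ln b)"
    using b Ln_S by (intro algebraic_primitive_compose analytic_intros) auto
  moreover have "(\<lambda>u. h (exp u) * deriv exp u) = g"
    by (simp add: g_def fun_eq_iff DERIV_imp_deriv[OF DERIV_exp])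
  ultimately have alg: "algebraic_primitive R (\<sigma> \<circ> exp) g (Ln b)" by simp
  obtain C where "\<And>u. u \<in> S \<Longrightarrow> eval_bipoly R ((\<sigma> \<circ> exp) u) (H u + C) = 0"
    using algebraic_primitive_extends[OF S(1,3) \<sigma>e Ln_S(1)[OF b(1)] H alg] by blast
  then have C: "\<And>u. u \<in> S \<Longrightarrow> eval_bipoly R (\<sigma> (exp u)) (H u + C) = 0"
    by simp
  define T :: complex where "T = 2 * of_real pi * \<i>"
  have ST: "u + T \<in> S" if "u \<in> S" for u using that by (simp add: S_def T_def)
  have expT: "exp (u + T) = exp u" for u
    by (simp add: T_def exp_add)
  have "\<exists>D. \<forall>u\<in>S. H (u + T) - H u = D"
  proof (rule has_field_derivative_zero_constant[OF S(2)])
    fix u assume u: "u \<in> S"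
    have "((\<lambda>u. H (u + T)) has_field_derivative g (u + T)) (at u)"
      using H[OF ST[OF u]] by (simp add: DERIV_shift)
    from DERIV_diff[OF this H[OF u]]
    have "((\<lambda>u. H (u + T) - H u) has_field_derivative g (u + T) - g u) (at u)" .
    then show "((\<lambda>u. H (u + T) - H u) has_field_derivative 0) (at u within S)"
      by (auto simp: g_def expT intro: has_field_derivative_at_within)
  qed
  then obtain D where D: "\<And>u. u \<in> S \<Longrightarrow> H (u + T) = H u + D"
    by (auto simp: algebra_simps)
  define u0 :: complex where "u0 = of_real (ln (r / 2))"
  have u0: "u0 \<in> S" using assms(1) by (simp add: u0_def S_def)
  have seg: "path_image (linepath u0 (u0 + T)) \<subseteq> S"
    using closed_segment_subset[OF u0 ST[OF u0] S(2)] by simp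
  \<comment> \<open>The period \<open>D\<close> is the integral over a vertical segment;
    substituting \<open>exp\<close> makes it an integral over a circle, that is 2 \<pi> i times the
    residue.\<close>
  have "(g has_contour_integral (H (u0 + T) - H u0)) (linepath u0 (u0 + T))"
    using contour_integral_primitive[of S H g "linepath u0 (u0 + T)", OF H0 _ seg] by simp
  then have "D = contour_integral (linepath u0 (u0 + T)) g"
    using D[OF u0] by (simp add: contour_integral_unique)
  also have "\<dots> = contour_integral (linepath u0 (u0 + T)) (\<lambda>w. deriv exp w * h (exp w))"
    by (simp add: g_def mult.commute DERIV_imp_deriv[OF DERIV_exp])
  also have "\<dots> = contour_integral (exp \<circ> linepath u0 (u0 + T)) h"
    by (rule contour_integral_comp_analyticW[symmetric, of exp UNIV]) (auto intro!: analytic_intros)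
  also have "exp \<circ> linepath u0 (u0 + T) = circlepath 0 (r / 2)"
    unfolding u0_def T_def using assms(1) by (intro linepath_exp_eq_circlepath) auto
  also have "contour_integral (circlepath 0 (r / 2)) h = 2 * pi * \<i> * residue h 0"
    by (rule contour_integral_unique, rule base_residue[of "ball 0 r"]) (use assms(1,2) in auto)
  finally have "D \<noteq> 0" using res by simp
  have "u + of_nat m * T \<in> S \<and> H (u + of_nat m * T) = H u + of_nat m * D" if "u \<in> S" for u m
  proof (induction m)
    case (Suc m)
    then show ?case
      using D[of "u + of_nat m * T"] ST[of "u + of_nat m * T"] by (simp add: algebra_simps)
  qed (use that in auto)
  then have root: "eval_bipoly R (\<sigma> (exp u)) (H u + of_nat m * D + C) = 0" if "u \<in> S" for u m
  proof -
    have "exp (u + of_nat m * T) = exp u"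
      by (induction m) (auto simp: algebra_simps exp_add T_def)
    then show ?thesis
      using C[of "u + of_nat m * T"] \<open>\<And>u m. u \<in> S \<Longrightarrow> u + of_nat m * T \<in> S \<and> _\<close>[OF that] by metis
  qed
  \<comment> \<open>At a fixed \<open>t\<close> the values H + m D + C are infinitely many roots of
    one polynomial in one variable, so that polynomial is zero. As \<sigma> takes infinitely many
    values, all coefficients of \<open>R\<close> then vanish.\<close>
  have coeff0: "poly (coeff R j) (\<sigma> t) = 0" if t: "t \<in> ball 0 r - {0}" for j t
  proof -
    define q where "q = map_poly (\<lambda>q. poly q (\<sigma> t)) R"
    have "range (\<lambda>m::nat. H (Ln t) + of_nat m * D + C) \<subseteq> {y. poly q y = 0}"
      using root[OF Ln_S(1)[OF t]] Ln_S(2)[OF t] by (auto simp: q_def eval_bipoly_def)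
    moreover have "infinite (range (\<lambda>m::nat. H (Ln t) + of_nat m * D + C))"
      using \<open>D \<noteq> 0\<close> by (intro range_inj_infinite) (auto simp: inj_def)
    ultimately have "q = 0" using poly_roots_finite infinite_super by blast
    then have "coeff q j = 0" by simp
    then show ?thesis by (simp add: q_def coeff_map_poly)
  qed
  obtain j where "coeff R j \<noteq> 0" using \<open>R \<noteq> 0\<close> by (metis leading_coeff_0_iff)
  then have "finite {x. poly (coeff R j) x = 0}" by (rule poly_roots_finite)
  moreover have "\<sigma> ` (ball 0 r - {0}) \<subseteq> {x. poly (coeff R j) x = 0}" using coeff0 by auto
  ultimately show False using assms(7) finite_subset by blast
qed

section \<open>The curve form and its algebraic primitive near 0\<close>

text \<open>
  If \<open>\<phi> = f'/f\<close> then \<open>curve_form M \<phi>\<close> is the derivative of the second component of the curve.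
\<close>

definition curve_form :: "nat \<Rightarrow> (complex \<Rightarrow> complex) \<Rightarrow> complex \<Rightarrow> complex" where
  "curve_form M \<phi> s = 2 * of_nat M * \<i> * (s ^ (2 * M - 1) + s ^ (2 * M) * \<phi> s)"

text \<open>Trades the integral over a varying segment for a fixed primitive \<open>G\<close>, which
  can be differentiated in \<open>s\<close>.\<close>

lemma gamma_param_snd:
  assumes "ereal r \<le> fps_conv_radius L" "norm s < r" "M \<ge> 1"
    and "\<And>x. x \<in> ball 0 r \<Longrightarrow>
      (G has_field_derivative x ^ (2 * M) * eval_fps (fps_deriv L) x) (at x within ball 0 r)"
  shows "snd (gamma_param c M L s) = \<i> * s ^ (2 * M) + \<i> * 2 * of_nat M * (G s - G 0)"
proof -
  have "0 < r" using assms(2) norm_ge_zero le_less_trans by blast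
  have "path_image (linepath 0 s) \<subseteq> ball 0 r"
    using closed_segment_subset[of 0 "ball 0 r" s] assms(2) \<open>0 < r\<close> by simp
  then have "contour_integral (linepath 0 s) (\<lambda>x. x ^ (2 * M) * eval_fps (fps_deriv L) x) = G s - G 0"
    using contour_integral_primitive[of "ball 0 r" G _ "linepath 0 s"] assms(4)
    by (intro contour_integral_unique) auto
  then show ?thesis by (simp add: gamma_param_def)
qed

text \<open>Passes from germs to power series, applies
  \<open>relations_from_parametrized_curve\<close>, and passes back. The algebraic primitive is the
  second component of the curve itself.\<close>

lemma algebraic_germ_relations:
  fixes M :: nat and c :: complex and L :: "complex fps" and f :: "complex \<Rightarrow> complex"
  assumes "M \<ge> 1" "c \<noteq> 0" "convergent_fps L" "fps_nth L 0 = 0"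
    and "algebraic_param (gamma_param c M L)"
  defines "f \<equiv> (\<lambda>s. exp (eval_fps L s))"
  shows "algebraic_function f 0"
    and "\<exists>R. R \<noteq> 0 \<and> (\<forall>\<^sub>F z in nhds 0. algebraic_primitive R id (curve_form M (\<lambda>s. deriv f s / f s)) z)"
proof -
  have "0 < fps_conv_radius L" using assms(3) by (simp add: convergent_fps_def)
  then obtain r where r: "0 < r" "ereal r < fps_conv_radius L"
    using ereal_dense2[of 0 "fps_conv_radius L"] by (auto simp: zero_ereal_def)
  have inL: "ereal (norm s) < fps_conv_radius L" if "s \<in> ball 0 r" for s
    using that r(2) by (auto intro: less_trans[of _ "ereal r"])
  define E where "E = fps_exp 1 oo L"
  define L' where "L' = eval_fps (fps_deriv L)"
  have Lexp: "eval_fps L has_fps_expansion L"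
    using \<open>0 < fps_conv_radius L\<close> by (rule eval_fps_has_fps_expansion)
  have L'exp: "L' has_fps_expansion fps_deriv L"
    unfolding L'_def using \<open>0 < fps_conv_radius L\<close> fps_conv_radius_deriv[of L]
    by (intro eval_fps_has_fps_expansion) (auto intro: less_le_trans)
  have Ldiff: "(eval_fps L has_field_derivative L' s) (at s)" if "s \<in> ball 0 r" for s
    unfolding L'_def by (rule has_field_derivative_eval_fps[OF inL[OF that]])
  have fexp: "f has_fps_expansion E"
    using has_fps_expansion_compose[OF has_fps_expansion_exp1 Lexp assms(4)]
    by (simp add: f_def E_def o_def)
  have fdiff: "(f has_field_derivative f s * L' s) (at s)" if "s \<in> ball 0 r" for s
    unfolding f_def by (rule DERIV_chain2[OF DERIV_exp Ldiff[OF that]])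
  have logder: "deriv f s / f s = L' s" if "s \<in> ball 0 r" for s
    using DERIV_imp_deriv[OF fdiff[OF that]] by (simp add: f_def)
  have near: "\<forall>\<^sub>F s in nhds 0. s \<in> ball 0 r"
    using r(1) by (intro eventually_nhds_in_open) auto
  have "(\<lambda>x. x ^ (2 * M) * L' x) holomorphic_on ball 0 r"
    unfolding L'_def using inL fps_conv_radius_deriv[of L]
    by (intro holomorphic_intros subsetI) (use less_le_trans in \<open>fastforce simp: eball_def\<close>)
  then obtain G where G: "\<And>x. x \<in> ball 0 r \<Longrightarrow>
      (G has_field_derivative x ^ (2 * M) * L' x) (at x within ball 0 r)"
    using holomorphic_convex_primitive'[of "ball 0 r"] by auto
  define w where "w = (\<lambda>s. \<i> * s ^ (2 * M) + \<i> * 2 * of_nat M * (G s - G 0))"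
  have w: "snd (gamma_param c M L s) = w s" if "s \<in> ball 0 r" for s
    unfolding w_def using gamma_param_snd[of r L s M G c] r(2) that assms(1) G
    by (simp add: L'_def)
  have wdiff: "(w has_field_derivative curve_form M L' s) (at s)" if s: "s \<in> ball 0 r" for s
  proof -
    have "(G has_field_derivative s ^ (2 * M) * L' s) (at s)"
      using G[OF s] s by (metis at_within_open open_ball)
    then show ?thesis
      unfolding w_def curve_form_def
      by (auto intro!: derivative_eq_intros simp: algebra_simps)
  qed
  have "w holomorphic_on ball 0 r"
    using wdiff by (metis holomorphic_on_open open_ball)
  then have "w analytic_on {0}" using r(1) unfolding analytic_at by (intro exI[of _ "ball 0 r"]) auto
  then obtain W where Wexp: "w has_fps_expansion W"
    using analytic_at_imp_has_fps_expansion_0 by blast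
  have "\<forall>\<^sub>F s in nhds 0. deriv w s = curve_form M L' s"
    using near by eventually_elim (rule DERIV_imp_deriv[OF wdiff])
  then have "curve_form M L' has_fps_expansion fps_deriv W"
    using has_fps_expansion_deriv[OF Wexp] has_fps_expansion_cong by blast
  moreover have "curve_form M L' has_fps_expansion
      fps_const (2 * of_nat M * \<i>) * (fps_X ^ (2 * M - 1) + fps_X ^ (2 * M) * fps_deriv L)"
    unfolding curve_form_def by (intro fps_expansion_intros L'exp)
  ultimately have W': "fps_deriv W =
      fps_const (2 * of_nat M * \<i>) * (fps_X ^ (2 * M - 1) + fps_X ^ (2 * M) * fps_deriv L)"
    by (rule fps_expansion_unique_complex)
  define Z where "Z = fps_const c * (fps_X * E) ^ M"
  have Zexp: "(\<lambda>s. c * (s * f s) ^ M) has_fps_expansion Z"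
    unfolding Z_def by (intro fps_expansion_intros fexp)
  have z: "fst (gamma_param c M L s) = c * (s * f s) ^ M" for s
    by (simp add: gamma_param_def f_def power_mult_distrib exp_of_nat_mult)
  have E': "fps_deriv E = E * fps_deriv L"
    unfolding E_def using assms(4) by (simp add: fps_compose_deriv)
  have "E $ 0 = 1" by (simp add: E_def)
  then have "E \<noteq> 0" by auto
  \<comment> \<open>Both sides contain the factor 1 + s L': w' = 2 M i s^(2M-1) (1 + s L') and s z'
    = M z (1 + s L'). Writing M as \<open>Suc m\<close> avoids truncated subtraction.\<close>
  have ZW: "fps_deriv W * Z = fps_const (2 * \<i>) * fps_X ^ (2 * M) * fps_deriv Z"
  proof -
    obtain m where m: "M = Suc m" using assms(1) by (cases M) auto
    have Y': "fps_deriv (fps_X * E) = E * (1 + fps_X * fps_deriv L)"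
      by (simp add: E' algebra_simps)
    have "fps_deriv Z = fps_const c * (fps_const (of_nat M) * (fps_X * E) ^ m * E * (1 + fps_X * fps_deriv L))"
      unfolding Z_def m
      by (simp only: fps_deriv_mult_const_left fps_deriv_power Y' diff_Suc_1) (simp only: mult_ac)
    moreover have "fps_deriv W = fps_const (2 * \<i>) * fps_const (of_nat M) * fps_X ^ (2 * m + 1) * (1 + fps_X * fps_deriv L)"
    proof -
      have "fps_const (2 * of_nat M * \<i>) = fps_const (2 * \<i>) * fps_const (of_nat M :: complex)"
        by (simp add: mult_ac)
      moreover have "2 * M - 1 = 2 * m + 1" "2 * M = Suc (2 * m + 1)" by (simp_all add: m)
      ultimately show ?thesis
        unfolding W' by (simp only: power_Suc ring_distribs mult_1_right mult_1_left mult_ac)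
    qed
    moreover have "Z = fps_const c * (fps_X * E) ^ m * fps_X * E"
      unfolding Z_def m by (simp add: mult_ac)
    moreover have "(fps_X :: complex fps) ^ (2 * M) = fps_X ^ (2 * m + 1) * fps_X"
      unfolding m by simp
    ultimately show ?thesis by (simp only: mult_ac)
  qed
  obtain P where P: "irreducible P"
    "\<forall>\<^sub>F s in nhds 0. eval_bipoly P (fst (gamma_param c M L s)) (snd (gamma_param c M L s)) = 0"
    using assms(5) unfolding algebraic_param_def by blast
  have "\<forall>\<^sub>F s in nhds 0. eval_bipoly P (c * (s * f s) ^ M) (w s) = 0"
    using P(2) near by eventually_elim (simp add: w z)
  then have "(\<lambda>s. eval_bipoly P (c * (s * f s) ^ M) (w s)) has_fps_expansion 0"
    by (simp add: has_fps_expansion_0_iff)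
  then have "eval2 P Z W = 0"
    using fps_expansion_unique_complex has_fps_expansion_eval_bipoly[OF Zexp Wexp] by blast
  moreover have "P \<noteq> 0" using P(1) by auto
  ultimately obtain R Q where R: "R \<noteq> 0" "eval2 R fps_X W = 0" and Q: "Q \<noteq> 0" "eval2 Q fps_X E = 0"
    using relations_from_parametrized_curve[OF assms(1,2) \<open>E \<noteq> 0\<close>, of P W] ZW
    unfolding Z_def by blast
  have "\<forall>\<^sub>F s in nhds 0. eval_bipoly Q s (f s) = 0"
    using has_fps_expansion_eval_bipoly[OF has_fps_expansion_fps_X fexp, of Q] Q(2)
    by (simp add: has_fps_expansion_0_iff)
  \<comment> \<open>A relation of degree 0 would be a nonzero polynomial in s alone that vanishes
    identically.\<close>
  moreover have "degree Q > 0"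
  proof (rule ccontr)
    assume "\<not> degree Q > 0"
    then obtain q where "Q = [:q:]" by (auto elim: degree_eq_zeroE)
    then show False
      using Q nonconstant_fps_transcendental[of fps_X q] by simp
  qed
  ultimately show "algebraic_function f 0"
    unfolding algebraic_function_def using Q(1) has_fps_expansion_imp_analytic_0[OF fexp] by blast
  have "\<forall>\<^sub>F s in nhds 0. eval_bipoly R s (w s) = 0"
    using has_fps_expansion_eval_bipoly[OF has_fps_expansion_fps_X Wexp, of R] R(2)
    by (simp add: has_fps_expansion_0_iff)
  with near have "\<forall>\<^sub>F s in nhds 0.
      (w has_field_derivative curve_form M (\<lambda>s. deriv f s / f s) s) (at s) \<and> eval_bipoly R (id s) (w s) = 0"
    by eventually_elim (use wdiff logder in \<open>auto simp: curve_form_def\<close>)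
  then have "\<forall>\<^sub>F z in nhds 0. \<forall>\<^sub>F s in nhds z.
      (w has_field_derivative curve_form M (\<lambda>s. deriv f s / f s) s) (at s) \<and> eval_bipoly R (id s) (w s) = 0"
    by (simp add: eventually_eventually)
  then have "\<forall>\<^sub>F z in nhds 0. algebraic_primitive R id (curve_form M (\<lambda>s. deriv f s / f s)) z"
    unfolding algebraic_primitive_def by (rule eventually_mono) blast
  with R(1) show "\<exists>R. R \<noteq> 0 \<and>
      (\<forall>\<^sub>F z in nhds 0. algebraic_primitive R id (curve_form M (\<lambda>s. deriv f s / f s)) z)"
    by blast
qed

section \<open>The algebraic primitive along analytic continuations\<close>

lemma eventually_nhds_imp_at: "\<forall>\<^sub>F z in nhds a. P z \<Longrightarrow> \<forall>\<^sub>F z in at a. P z"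
  by (auto simp: eventually_nhds_conv_at)

lemma curve_form_cong:
  "\<forall>\<^sub>F z in F. \<phi> z = \<psi> z \<Longrightarrow> \<forall>\<^sub>F z in F. curve_form M \<phi> z = curve_form M \<psi> z"
  by (erule eventually_mono) (simp add: curve_form_def)

text \<open>Common core of two situations: f'/f itself is continued, with analytic germs, or f is
  continued and f'/f is formed afterwards, with possible poles.\<close>

lemma algebraic_primitive_continues:
  fixes p :: "real \<Rightarrow> complex"
  assumes "path p"
    and hol: "\<And>t. t \<in> {0..1} \<Longrightarrow> \<exists>e>0. \<phi> t holomorphic_on (ball (p t) e - {p t})"
    and cont: "\<And>t. t \<in> {0..1} \<Longrightarrow>
       \<exists>e>0. \<forall>u\<in>{0..1}. \<bar>u - t\<bar> < e \<longrightarrow> (\<forall>\<^sub>F z in at (p u). \<phi> u z = \<phi> t z)"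
    and "\<forall>\<^sub>F z in at (p 0). algebraic_primitive R id (curve_form M (\<phi> 0)) z"
  shows "\<forall>\<^sub>F z in at (p 1). algebraic_primitive R id (curve_form M (\<phi> 1)) z"
proof (rule property_transported_along_path[OF assms(1), where h = "\<lambda>t. curve_form M (\<phi> t)"
      and Q = "algebraic_primitive R id"])
  fix t :: real assume t: "t \<in> {0..1}"
  show "\<exists>e>0. curve_form M (\<phi> t) holomorphic_on (ball (p t) e - {p t})"
    using hol[OF t] unfolding curve_form_def by (auto intro!: holomorphic_intros)
  show "\<exists>e>0. \<forall>u\<in>{0..1}. \<bar>u - t\<bar> < e \<longrightarrow>
      (\<forall>\<^sub>F z in at (p u). curve_form M (\<phi> u) z = curve_form M (\<phi> t) z)"
    using cont[OF t] curve_form_cong by meson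
qed (rule algebraic_primitive_cong, assumption, assumption,
    rule algebraic_primitive_connected[OF _ _ holomorphic_on_id], assumption+, rule assms(4), simp)

text \<open>Serves the claim at infinity, where the germ being continued is f'/f.\<close>

lemma algebraic_primitive_continues_along:
  assumes "continues_along \<phi> p \<psi>"
    and "\<forall>\<^sub>F z in nhds (pathstart p). algebraic_primitive R id (curve_form M \<phi>) z"
  shows "\<forall>\<^sub>F z in at (pathfinish p). algebraic_primitive R id (curve_form M \<psi>) z"
proof -
  obtain G where "path p" and G: "\<And>t. t \<in> {0..1} \<Longrightarrow> G t analytic_on {p t}"
    "\<And>t. t \<in> {0..1} \<Longrightarrow> \<exists>e>0. \<forall>u\<in>{0..1}. \<bar>u - t\<bar> < e \<longrightarrow> (\<forall>\<^sub>F z in nhds (p u). G u z = G t z)"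
    and G01: "\<forall>\<^sub>F z in nhds (pathstart p). G 0 z = \<phi> z" "\<forall>\<^sub>F z in nhds (pathfinish p). G 1 z = \<psi> z"
    using assms(1) unfolding continues_along_def by blast
  have swap: "\<forall>\<^sub>F z in nhds a. algebraic_primitive R id (curve_form M f) z \<longrightarrow>
      algebraic_primitive R id (curve_form M g) z" if "\<forall>\<^sub>F z in nhds a. f z = g z" for f g a
  proof -
    have "\<forall>\<^sub>F z in nhds a. \<forall>\<^sub>F y in nhds z. curve_form M f y = curve_form M g y"
      using curve_form_cong[OF that] by (simp add: eventually_eventually)
    then show ?thesis by eventually_elim (use algebraic_primitive_cong in blast)
  qed
  have "\<forall>\<^sub>F z in at (p 1). algebraic_primitive R id (curve_form M (G 1)) z"
  proof (rule algebraic_primitive_continues[OF \<open>path p\<close>])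
    fix t :: real assume t: "t \<in> {0..1}"
    obtain e where "e > 0" "G t holomorphic_on ball (p t) e"
      using G(1)[OF t] by (auto simp: analytic_on_def)
    then show "\<exists>e>0. G t holomorphic_on (ball (p t) e - {p t})"
      using holomorphic_on_subset by blast
    show "\<exists>e>0. \<forall>u\<in>{0..1}. \<bar>u - t\<bar> < e \<longrightarrow> (\<forall>\<^sub>F z in at (p u). G u z = G t z)"
      using G(2)[OF t] eventually_nhds_imp_at by meson
  next
    have "\<forall>\<^sub>F z in nhds (pathstart p). \<phi> z = G 0 z" using G01(1) by eventually_elim simp
    from swap[OF this] assms(2)
    have "\<forall>\<^sub>F z in nhds (pathstart p). algebraic_primitive R id (curve_form M (G 0)) z"
      by eventually_elim blast
    then show "\<forall>\<^sub>F z in at (p 0). algebraic_primitive R id (curve_form M (G 0)) z"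
      unfolding pathstart_def by (rule eventually_nhds_imp_at)
  qed
  moreover have "\<forall>\<^sub>F z in at (p 1). algebraic_primitive R id (curve_form M (G 1)) z \<longrightarrow>
      algebraic_primitive R id (curve_form M \<psi>) z"
    using swap[OF G01(2)] unfolding pathfinish_def by (rule eventually_nhds_imp_at)
  ultimately show ?thesis
    unfolding pathfinish_def by eventually_elim blast
qed

text \<open>Not vanishing identically is the property that can be transported, by the identity
  theorem. Isolation of zeros then gives nonvanishing near each point of the path, but not at the
  point.\<close>

lemma nonzero_germ_continues:
  fixes p :: "real \<Rightarrow> complex"
  assumes "path p" and G: "\<And>t. t \<in> {0..1} \<Longrightarrow> G t analytic_on {p t}"
    "\<And>t. t \<in> {0..1} \<Longrightarrow> \<exists>e>0. \<forall>u\<in>{0..1}. \<bar>u - t\<bar> < e \<longrightarrow> (\<forall>\<^sub>F z in nhds (p u). G u z = G t z)"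
    and "\<forall>\<^sub>F z in nhds (p 0). G 0 z \<noteq> 0" and t: "t \<in> {0..1}"
  shows "\<forall>\<^sub>F z in at (p t). G t z \<noteq> 0"
proof -
  have hol: "\<exists>e>0. G t holomorphic_on ball (p t) e" if "t \<in> {0..1}" for t
    using G(1)[OF that] by (auto simp: analytic_on_def)
  have nz: "\<forall>\<^sub>F z in at (p t). \<not> (\<forall>\<^sub>F y in nhds z. G t y = 0)"
  proof (rule property_transported_along_path[OF assms(1), where Q = "\<lambda>f z. \<not> (\<forall>\<^sub>F y in nhds z. f y = 0)"])
    fix t :: real assume t: "t \<in> {0..1}"
    show "\<exists>e>0. G t holomorphic_on (ball (p t) e - {p t})"
      using hol[OF t] holomorphic_on_subset by blast
    show "\<exists>e>0. \<forall>u\<in>{0..1}. \<bar>u - t\<bar> < e \<longrightarrow> (\<forall>\<^sub>F z in at (p u). G u z = G t z)"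
      using G(2)[OF t] eventually_nhds_imp_at by meson
  next
    fix f g :: "complex \<Rightarrow> complex" and z
    assume eq: "\<forall>\<^sub>F y in nhds z. f y = g y" and nz: "\<not> (\<forall>\<^sub>F y in nhds z. f y = 0)"
    show "\<not> (\<forall>\<^sub>F y in nhds z. g y = 0)"
    proof
      assume "\<forall>\<^sub>F y in nhds z. g y = 0"
      with eq have "\<forall>\<^sub>F y in nhds z. f y = 0" by eventually_elim simp
      with nz show False by blast
    qed
  next
    fix f :: "complex \<Rightarrow> complex" and S a b
    assume S: "open S" "connected S" "f holomorphic_on S" "a \<in> S" "b \<in> S"
      and nz: "\<not> (\<forall>\<^sub>F y in nhds a. f y = 0)"
    show "\<not> (\<forall>\<^sub>F y in nhds b. f y = 0)"
    proof
      assume "\<forall>\<^sub>F y in nhds b. f y = 0"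
      then obtain U where U: "open U" "b \<in> U" "\<And>y. y \<in> U \<Longrightarrow> f y = 0"
        unfolding eventually_nhds by blast
      have "f y = 0" if "y \<in> S" for y
        by (rule analytic_continuation_open[of "U \<inter> S" S f "\<lambda>_. 0"]) (use U S that in auto)
      then show False
        using nz S(1,4) unfolding eventually_nhds by blast
    qed
  next
    have "\<forall>\<^sub>F z in nhds (p 0). \<forall>\<^sub>F y in nhds z. G 0 y \<noteq> 0"
      using assms(4) by (simp add: eventually_eventually)
    then have "\<forall>\<^sub>F z in nhds (p 0). \<not> (\<forall>\<^sub>F y in nhds z. G 0 y = 0)"
      by (rule eventually_mono) (auto dest: eventually_nhds_x_imp_x)
    then show "\<forall>\<^sub>F z in at (p 0). \<not> (\<forall>\<^sub>F y in nhds z. G 0 y = 0)" by (rule eventually_nhds_imp_at)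
  qed (rule t)
  obtain e where e: "e > 0" "G t holomorphic_on ball (p t) e" using hol[OF t] by blast
  have "\<forall>\<^sub>F z in at (p t). z \<in> ball (p t) e"
    using e(1) by (intro eventually_at_in_open') auto
  with nz have "\<forall>\<^sub>F z in at (p t). z \<in> ball (p t) e \<and> \<not> (\<forall>\<^sub>F y in nhds z. G t y = 0)"
    by eventually_elim simp
  then obtain z where z: "z \<in> ball (p t) e" "\<not> (\<forall>\<^sub>F y in nhds z. G t y = 0)"
    using eventually_happens'[OF at_neq_bot] by blast
  have near: "\<forall>\<^sub>F y in nhds z. y \<in> ball (p t) e"
    using z(1) by (intro eventually_nhds_in_open) auto
  have "\<not> (\<forall>y\<in>ball (p t) e. G t y = 0)"
  proof
    assume *: "\<forall>y\<in>ball (p t) e. G t y = 0"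
    from near have "\<forall>\<^sub>F y in nhds z. G t y = 0" by eventually_elim (use * in blast)
    with z(2) show False by blast
  qed
  then obtain y where "y \<in> ball (p t) e" "G t y \<noteq> 0"
    by blast
  then have "\<forall>\<^sub>F w in at (p t). G t w \<noteq> 0 \<and> w \<in> ball (p t) e"
    using e by (intro non_zero_neighbour_alt) auto
  then show ?thesis by eventually_elim simp
qed

text \<open>Serves the claim on zeros and poles, where f is continued. Zeros of the germs on the
  path are isolated by \<open>nonzero_germ_continues\<close>, so their logarithmic derivatives are
  holomorphic on punctured discs.\<close>

lemma algebraic_primitive_continues_along_logderiv:
  assumes "continues_along f p g" and "\<forall>\<^sub>F z in nhds (pathstart p). f z \<noteq> 0"
    and "\<forall>\<^sub>F z in nhds (pathstart p). algebraic_primitive R id (curve_form M (\<lambda>s. deriv f s / f s)) z"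
  shows "\<forall>\<^sub>F z in at (pathfinish p). algebraic_primitive R id (curve_form M (\<lambda>s. deriv g s / g s)) z"
    and "g analytic_on {pathfinish p}"
proof -
  obtain G where "path p" and G: "\<And>t. t \<in> {0..1} \<Longrightarrow> G t analytic_on {p t}"
    "\<And>t. t \<in> {0..1} \<Longrightarrow> \<exists>e>0. \<forall>u\<in>{0..1}. \<bar>u - t\<bar> < e \<longrightarrow> (\<forall>\<^sub>F z in nhds (p u). G u z = G t z)"
    and G01: "\<forall>\<^sub>F z in nhds (pathstart p). G 0 z = f z" "\<forall>\<^sub>F z in nhds (pathfinish p). G 1 z = g z"
    using assms(1) unfolding continues_along_def by blast
  show "g analytic_on {pathfinish p}"
    using analytic_at_cong[OF G01(2)] G(1)[of 1] by (simp add: pathfinish_def)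
  have logderiv: "\<forall>\<^sub>F z in nhds a. deriv h z / h z = deriv k z / k z"
    if "\<forall>\<^sub>F z in nhds a. h z = k z" for a and h k :: "complex \<Rightarrow> complex"
  proof -
    have "\<forall>\<^sub>F z in nhds a. \<forall>\<^sub>F y in nhds z. h y = k y"
      using that by (simp add: eventually_eventually)
    then show ?thesis
      by eventually_elim (auto dest: eventually_nhds_x_imp_x intro: deriv_cong_ev arg_cong2[of _ _ _ _ "(/)"])
  qed
  have swap: "\<forall>\<^sub>F z in nhds a. algebraic_primitive R id (curve_form M (\<lambda>s. deriv h s / h s)) z \<longrightarrow>
      algebraic_primitive R id (curve_form M (\<lambda>s. deriv k s / k s)) z"
    if "\<forall>\<^sub>F z in nhds a. h z = k z" for a and h k :: "complex \<Rightarrow> complex"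
  proof -
    have "\<forall>\<^sub>F z in nhds a. \<forall>\<^sub>F y in nhds z.
        curve_form M (\<lambda>s. deriv h s / h s) y = curve_form M (\<lambda>s. deriv k s / k s) y"
      using curve_form_cong[OF logderiv[OF that]] by (simp add: eventually_eventually)
    then show ?thesis by eventually_elim (use algebraic_primitive_cong in blast)
  qed
  have "\<forall>\<^sub>F z in nhds (p 0). G 0 z \<noteq> 0"
    using assms(2) G01(1) unfolding pathstart_def by eventually_elim simp
  then have nz: "\<forall>\<^sub>F z in at (p t). G t z \<noteq> 0" if "t \<in> {0..1}" for t
    using nonzero_germ_continues[of p G t] \<open>path p\<close> G that by blast
  have "\<forall>\<^sub>F z in at (p 1). algebraic_primitive R id (curve_form M (\<lambda>s. deriv (G 1) s / G 1 s)) z"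
  proof (rule algebraic_primitive_continues[OF \<open>path p\<close>, where \<phi> = "\<lambda>t s. deriv (G t) s / G t s"])
    fix t :: real assume t: "t \<in> {0..1}"
    obtain e where e: "e > 0" "G t holomorphic_on ball (p t) e"
      using G(1)[OF t] by (auto simp: analytic_on_def)
    obtain d where d: "d > 0" "\<And>z. z \<noteq> p t \<Longrightarrow> dist z (p t) < d \<Longrightarrow> G t z \<noteq> 0"
      using nz[OF t] unfolding eventually_at by blast
    have "(\<lambda>s. deriv (G t) s / G t s) holomorphic_on (ball (p t) (min e d) - {p t})"
      using d(2) by (intro holomorphic_intros holomorphic_on_subset[OF holomorphic_deriv[OF e(2)]]
          holomorphic_on_subset[OF e(2)]) (auto simp: dist_commute)
    then show "\<exists>e>0. (\<lambda>s. deriv (G t) s / G t s) holomorphic_on (ball (p t) e - {p t})"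
      using e(1) d(1) by (intro exI[of _ "min e d"]) auto
    show "\<exists>e>0. \<forall>u\<in>{0..1}. \<bar>u - t\<bar> < e \<longrightarrow>
        (\<forall>\<^sub>F z in at (p u). deriv (G u) z / G u z = deriv (G t) z / G t z)"
      using G(2)[OF t] eventually_nhds_imp_at[OF logderiv] by meson
  next
    have "\<forall>\<^sub>F z in nhds (pathstart p). f z = G 0 z" using G01(1) by eventually_elim simp
    from swap[OF this] assms(3)
    have "\<forall>\<^sub>F z in nhds (pathstart p). algebraic_primitive R id (curve_form M (\<lambda>s. deriv (G 0) s / G 0 s)) z"
      by eventually_elim blast
    then show "\<forall>\<^sub>F z in at (p 0). algebraic_primitive R id (curve_form M (\<lambda>s. deriv (G 0) s / G 0 s)) z"
      unfolding pathstart_def by (rule eventually_nhds_imp_at)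
  qed
  moreover have "\<forall>\<^sub>F z in at (p 1). algebraic_primitive R id (curve_form M (\<lambda>s. deriv (G 1) s / G 1 s)) z \<longrightarrow>
      algebraic_primitive R id (curve_form M (\<lambda>s. deriv g s / g s)) z"
    using swap[OF G01(2)] unfolding pathfinish_def by (rule eventually_nhds_imp_at)
  ultimately show "\<forall>\<^sub>F z in at (pathfinish p). algebraic_primitive R id (curve_form M (\<lambda>s. deriv g s / g s)) z"
    unfolding pathfinish_def by eventually_elim blast
qed

section \<open>Residues in the uniformizing variable of a Puiseux series\<close>

text \<open>The function \<open>k\<close> is tied to the germ \<open>h\<close> only near
  \<open>t1\<close>; elsewhere on \<open>S\<close> it is its own holomorphic extension. The
  algebraic primitive is pulled back near \<open>t1\<close> and travels through \<open>S\<close> to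
  the punctured disc around 0.\<close>

lemma residue_pullback_0:
  assumes "\<forall>\<^sub>F z in at (\<sigma> t1). algebraic_primitive R id h z"
    and S: "open S" "connected S" "ball 0 r - {0} \<subseteq> S" "r > 0"
    and hol: "\<sigma> holomorphic_on S" "k holomorphic_on S"
    and t1: "\<sigma> analytic_on {t1}" "\<forall>\<^sub>F t in at t1. \<sigma> t \<noteq> \<sigma> t1" "\<forall>\<^sub>F t in at t1. t \<in> S"
    and eq: "\<forall>\<^sub>F t in at t1. h (\<sigma> t) * deriv \<sigma> t = k t"
    and R: "R \<noteq> 0" "infinite (\<sigma> ` (ball 0 r - {0}))"
  shows "residue k 0 = 0"
proof -
  have "\<sigma> \<midarrow>t1\<rightarrow> \<sigma> t1"
    using analytic_at_imp_isCont[OF t1(1)] by (simp add: isCont_def)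
  \<comment> \<open>\<sigma> must avoid its value at \<open>t1\<close>, because the primitive is
    only provided on a punctured neighbourhood of that value.\<close>
  then have "filterlim \<sigma> (at (\<sigma> t1)) (at t1)"
    using t1(2) by (simp add: filterlim_at)
  from eventually_compose_filterlim[OF assms(1) this]
  have alg: "\<forall>\<^sub>F t in at t1. algebraic_primitive R id h (\<sigma> t)" .
  have ana: "\<forall>\<^sub>F t in at t1. \<sigma> analytic_on {t}"
    using eventually_nhds_analytic_at[OF t1(1)] by (rule eventually_nhds_imp_at)
  have "\<forall>\<^sub>F t in at t1. t \<in> S \<and> algebraic_primitive R \<sigma> k t"
    using alg ana t1(3) eventually_at_imp_eventually_nhds[OF eq]
  proof eventually_elim
    case (elim t)
    have "algebraic_primitive R (id \<circ> \<sigma>) (\<lambda>\<tau>. h (\<sigma> \<tau>) * deriv \<sigma> \<tau>) t"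
      using elim by (intro algebraic_primitive_compose)
    then have "algebraic_primitive R \<sigma> (\<lambda>\<tau>. h (\<sigma> \<tau>) * deriv \<sigma> \<tau>) t" by simp
    with algebraic_primitive_cong[OF elim(4)] elim(3) show ?case by blast
  qed
  then obtain t where t: "t \<in> S" "algebraic_primitive R \<sigma> k t"
    using eventually_happens'[OF at_neq_bot] by blast
  define b :: complex where "b = of_real (r / 2)"
  have b: "b \<in> ball 0 r - {0}" using S(4) by (simp add: b_def)
  have "algebraic_primitive R \<sigma> k b"
    using algebraic_primitive_connected[OF S(1,2) hol t(1) _ t(2)] b S(3) by blast
  then show ?thesis
    using algebraic_primitive_imp_residue_0[OF S(4) _ _ b _ R] hol S(3) holomorphic_on_subset by blast
qed

lemma infinite_power_image_punctured_ball:
  assumes "r > 0" "k \<ge> 1"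
  shows "infinite ((\<lambda>t::complex. t ^ k) ` (ball 0 r - {0}))"
proof
  assume "finite ((\<lambda>t::complex. t ^ k) ` (ball 0 r - {0}))"
  then have "finite (\<Union>y\<in>(\<lambda>t::complex. t ^ k) ` (ball 0 r - {0}). {t. t ^ k = y})"
    using assms(2) by (intro finite_UN_I finite_nth_roots) auto
  moreover have "ball 0 r - {0} \<subseteq> (\<Union>y\<in>(\<lambda>t::complex. t ^ k) ` (ball 0 r - {0}). {t. t ^ k = y})"
    by blast
  ultimately have "finite (ball (0 :: complex) r - {0})" using finite_subset by blast
  then have "finite (ball (0 :: complex) r)" by simp
  then show False using assms(1) finite_imp_not_open[of "ball (0 :: complex) r"] by simp
qed

lemma eventually_power_neq:
  assumes "k \<ge> 1"
  shows "\<forall>\<^sub>F t in at t1. t ^ k \<noteq> (t1 :: complex) ^ k"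
proof -
  have "finite {t. t ^ k = t1 ^ k}" using assms by (intro finite_nth_roots) auto
  then have "open (- ({t. t ^ k = t1 ^ k} - {t1}))"
    by (intro open_Compl finite_imp_closed) auto
  then have "\<forall>\<^sub>F t in at t1. t \<in> - ({t. t ^ k = t1 ^ k} - {t1})"
    by (intro eventually_at_in_open') auto
  moreover have "\<forall>\<^sub>F t in at t1. t \<noteq> t1" by (rule eventually_neq_at_within)
  ultimately show ?thesis by eventually_elim auto
qed

text \<open>The residue of a logarithmic derivative is the order. With nonzero order, the derivative
  has order exactly one less, so F'/F has a simple pole.\<close>

lemma tendsto_logderiv_eval_fls:
  assumes "fls_conv_radius F > 0" "F \<noteq> 0" "fls_subdegree F \<noteq> 0"
  shows "(\<lambda>t. t * (eval_fls (fls_deriv F) t / eval_fls F t)) \<midarrow>0\<rightarrow> of_int (fls_subdegree F)"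
proof -
  have conv: "fls_conv_radius (fls_deriv F) > 0"
    using assms(1) fls_conv_radius_deriv[of F] by (rule less_le_trans)
  have F': "fls_deriv F \<noteq> 0" "fls_subdegree (fls_deriv F) = fls_subdegree F - 1"
  proof -
    have "fls_nth (fls_deriv F) (fls_subdegree F - 1) \<noteq> 0"
      using assms(2,3) by simp
    then show "fls_deriv F \<noteq> 0" by (rule fls_nonzeroI)
    show "fls_subdegree (fls_deriv F) = fls_subdegree F - 1"
      using assms(3) by (intro fls_subdegree_deriv) simp
  qed
  define Q where "Q = fls_X * (fls_deriv F / F)"
  have "(\<lambda>t. t * (eval_fls (fls_deriv F) t / eval_fls F t)) has_laurent_expansion Q"
    unfolding Q_def by (intro laurent_expansion_intros conv assms)
  moreover have "fls_subdegree Q = 0"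
    unfolding Q_def using F' assms(2)
    by (simp add: field_simps fls_divide_subdegree)
  moreover have "fls_nth Q 0 = of_int (fls_subdegree F)"
    unfolding Q_def using fls_residue_deriv_times_inverse_eq_subdegree[of F]
    by (simp add: fls_X_times_conv_shift divide_inverse)
  ultimately show ?thesis
    using has_laurent_expansion_imp_tendsto_0[of _ Q] by fastforce
qed

text \<open>Over s0 \<noteq> 0 the factor s^(2M) does not vanish, so the simple pole of F'/F
  survives in the pulled-back curve form.\<close>

lemma no_algebraic_zero_or_pole:
  fixes F :: "complex fls"
  assumes "M \<ge> 1" "R \<noteq> 0" "s0 \<noteq> 0" "F \<noteq> 0"
    and alg: "\<forall>\<^sub>F z in at a. algebraic_primitive R id (curve_form M (\<lambda>s. deriv g s / g s)) z"
    and "g analytic_on {a}" and "puiseux_expansion g a s0 k F"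
  shows "fls_subdegree F = 0"
proof (rule ccontr)
  assume n: "fls_subdegree F \<noteq> 0"
  obtain t1 where k: "k \<ge> 1" and t1: "t1 \<noteq> 0" "ereal (norm t1) < fls_conv_radius F" "t1 ^ k = a - s0"
    and gF: "\<forall>\<^sub>F t in nhds t1. g (s0 + t ^ k) = eval_fls F t"
    using assms(7) unfolding puiseux_expansion_def by blast
  \<comment> \<open>The disc has to contain \<open>t1\<close>, where the series meets
    \<open>g\<close>.\<close>
  obtain \<rho> where \<rho>: "norm t1 < \<rho>" "ereal \<rho> < fls_conv_radius F"
    using ereal_dense2[OF t1(2)] by auto
  have "\<rho> > 0" using \<rho>(1) norm_ge_zero le_less_trans by blast
  then have conv: "fls_conv_radius F > 0" using \<rho>(2) by (metis ereal_less(2) less_trans)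
  define B :: "complex set" where "B = ball 0 \<rho> - {0}"
  have Bsub: "B \<subseteq> eball 0 (fls_conv_radius F) - {0}"
  proof
    fix t assume "t \<in> B"
    then have "ereal (norm t) < ereal \<rho>" "t \<noteq> 0" by (auto simp: B_def)
    then show "t \<in> eball 0 (fls_conv_radius F) - {0}"
      using less_trans[OF _ \<rho>(2)] by (auto simp: eball_def)
  qed
  have B: "open B" "connected B" "t1 \<in> B"
    using t1(1) \<rho>(1) by (auto simp: B_def intro!: open_delete connected_punctured_ball)
  have holF: "eval_fls F holomorphic_on B"
    by (rule holomorphic_on_eval_fls) (use Bsub in auto)
  have holF': "eval_fls (fls_deriv F) holomorphic_on B"
  proof (rule holomorphic_on_eval_fls, rule subsetI)
    fix t assume "t \<in> B"
    then have "ereal (norm t) < fls_conv_radius F" "t \<noteq> 0" using Bsub by auto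
    then show "t \<in> eball 0 (fls_conv_radius (fls_deriv F)) -
        (if fls_subdegree (fls_deriv F) \<ge> 0 then {} else {0})"
      using less_le_trans[OF _ fls_conv_radius_deriv] by auto
  qed
  \<comment> \<open>Zeros of the series inside the disc are poles of F'/F. They form a sparse set,
    so removing them leaves a connected set.\<close>
  define Z where "Z = {t \<in> B. eval_fls F t = 0}"
  define S where "S = B - Z"
  have "\<forall>\<^sub>F t in at 0. t \<in> ball 0 \<rho>"
    using \<open>\<rho> > 0\<close> by (intro eventually_at_in_open') auto
  then have "\<forall>\<^sub>F t in at 0. t \<in> S"
    using has_laurent_expansion_nonzero_imp_eventually_nonzero[OF eval_fls_has_laurent_expansion[OF conv] assms(4)]
      eventually_neq_at_within[of 0 0 UNIV]
    by eventually_elim (auto simp: S_def B_def Z_def)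
  then obtain r where r: "r > 0" "ball 0 r - {0} \<subseteq> S"
    unfolding eventually_at by (auto simp: dist_commute subset_eq)
  then obtain \<beta> where \<beta>: "\<beta> \<in> B" "eval_fls F \<beta> \<noteq> 0"
    using \<open>\<forall>\<^sub>F t in at 0. t \<in> S\<close> eventually_happens'[OF at_neq_bot] unfolding S_def Z_def by blast
  have nz_at: "\<forall>\<^sub>F w in at z. eval_fls F w \<noteq> 0 \<and> w \<in> B" if "z \<in> B" for z
    by (rule non_zero_neighbour_alt[OF holF B(1,2) that \<beta>])
  have "Z sparse_in B"
    unfolding sparse_in_eventually_iff[OF B(1)] Z_def
    by (intro ballI eventually_mono[OF nz_at]) auto
  then have "connected S"
    unfolding S_def using sparse_imp_connected[OF _ B(2,1)] by simp
  have "S = B \<inter> eval_fls F -` (- {0})" by (auto simp: S_def Z_def)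
  then have "open S"
    using continuous_open_preimage[OF holomorphic_on_imp_continuous_on[OF holF] B(1)] by auto
  define \<sigma> where "\<sigma> = (\<lambda>t. s0 + t ^ k)"
  have \<sigma>t1: "\<sigma> t1 = a" by (simp add: \<sigma>_def t1(3))
  have d\<sigma>: "(\<sigma> has_field_derivative of_nat k * t ^ (k - 1)) (at t)" for t
    unfolding \<sigma>_def by (auto intro!: derivative_eq_intros)
  \<comment> \<open>The factor \<sigma>' of the substitution is absorbed in the second term:
    g'(\<sigma>) \<sigma>' = F', so g'/g pulls back to F'/F.\<close>
  define q where "q = (\<lambda>t. 2 * of_nat M * \<i> * (\<sigma> t ^ (2 * M - 1) * (of_nat k * t ^ (k - 1)) +
      \<sigma> t ^ (2 * M) * (eval_fls (fls_deriv F) t / eval_fls F t)))"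
  have nz: "eval_fls F t \<noteq> 0" if "t \<in> S" for t using that by (auto simp: S_def Z_def)
  have holq: "q holomorphic_on S"
    unfolding q_def \<sigma>_def using nz
    by (intro holomorphic_intros holomorphic_on_subset[OF holF] holomorphic_on_subset[OF holF'])
      (auto simp: S_def)
  have evS: "\<forall>\<^sub>F t in at t1. t \<in> S"
    using nz_at[OF B(3)] by eventually_elim (auto simp: S_def Z_def)
  have eq: "\<forall>\<^sub>F t in at t1. curve_form M (\<lambda>s. deriv g s / g s) (\<sigma> t) * deriv \<sigma> t = q t"
  proof -
    have "isCont \<sigma> t1" using d\<sigma> DERIV_isCont by blast
    then have "filterlim \<sigma> (nhds a) (at t1)" by (simp add: isCont_def \<sigma>t1)
    from eventually_compose_filterlim[OF eventually_nhds_analytic_at[OF assms(6)] this]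
    have "\<forall>\<^sub>F t in at t1. g analytic_on {\<sigma> t}" .
    moreover have "\<forall>\<^sub>F t in at t1. \<forall>\<^sub>F \<tau> in nhds t. g (\<sigma> \<tau>) = eval_fls F \<tau>"
      using gF unfolding \<sigma>_def by (intro eventually_nhds_imp_at) (simp add: eventually_eventually)
    ultimately show ?thesis
      using evS
    proof eventually_elim
      case (elim t)
      have "((\<lambda>\<tau>. g (\<sigma> \<tau>)) has_field_derivative deriv g (\<sigma> t) * (of_nat k * t ^ (k - 1))) (at t)"
        by (rule DERIV_chain2[OF analytic_derivI[OF elim(1)] d\<sigma>])
      then have "deriv g (\<sigma> t) * (of_nat k * t ^ (k - 1)) = deriv (eval_fls F) t"
        using DERIV_imp_deriv deriv_cong_ev[OF elim(2) refl] by metis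
      also have "\<dots> = eval_fls (fls_deriv F) t"
        using elim(3) Bsub by (intro eval_fls_deriv[symmetric]) (auto simp: S_def)
      finally have *: "deriv g (\<sigma> t) * (of_nat k * t ^ (k - 1)) = eval_fls (fls_deriv F) t" .
      have "g (\<sigma> t) = eval_fls F t" using elim(2) by (rule eventually_nhds_x_imp_x)
      then show ?case
        unfolding q_def curve_form_def DERIV_imp_deriv[OF d\<sigma>] *[symmetric]
        by (simp add: algebra_simps)
    qed
  qed
  have "infinite (\<sigma> ` (ball 0 r - {0}))"
  proof -
    have "\<sigma> ` (ball 0 r - {0}) = (+) s0 ` (\<lambda>t. t ^ k) ` (ball 0 r - {0})"
      by (simp add: image_image \<sigma>_def)
    then show ?thesis
      using infinite_power_image_punctured_ball[OF r(1) k] by (simp add: finite_image_iff)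
  qed
  moreover have "\<forall>\<^sub>F t in at t1. \<sigma> t \<noteq> \<sigma> t1"
    using eventually_power_neq[OF k, of t1] by eventually_elim (simp add: \<sigma>_def)
  moreover have "\<sigma> analytic_on {t1}" "\<sigma> holomorphic_on S"
    unfolding \<sigma>_def by (intro analytic_intros holomorphic_intros)+
  ultimately have "residue q 0 = 0"
    using alg evS eq assms(2) holq \<open>open S\<close> \<open>connected S\<close> r
    by (intro residue_pullback_0[of R "curve_form M (\<lambda>s. deriv g s / g s)" \<sigma> t1 S r]) (simp_all add: \<sigma>t1)
  moreover have "residue q 0 = 2 * of_nat M * \<i> * s0 ^ (2 * M) * of_int (fls_subdegree F)"
  proof (rule residue_simple'[of "ball 0 r"])
    show "q holomorphic_on ball 0 r - {0}" using holq r(2) by (rule holomorphic_on_subset)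
    \<comment> \<open>After multiplication by \<open>t\<close> the first term, which is a
      polynomial, tends to 0, and \<sigma>(0) = s0.\<close>
    have "(\<lambda>t. 2 * of_nat M * \<i> * (t * (\<sigma> t ^ (2 * M - 1) * (of_nat k * t ^ (k - 1))) +
        \<sigma> t ^ (2 * M) * (t * (eval_fls (fls_deriv F) t / eval_fls F t))))
      \<midarrow>0\<rightarrow> 2 * of_nat M * \<i> * (0 * (\<sigma> 0 ^ (2 * M - 1) * (of_nat k * 0 ^ (k - 1))) +
        \<sigma> 0 ^ (2 * M) * of_int (fls_subdegree F))"
      unfolding \<sigma>_def
      by (intro tendsto_intros tendsto_logderiv_eval_fls conv assms(4) n)
    then show "(\<lambda>t. q t * (t - 0)) \<midarrow>0\<rightarrow> 2 * of_nat M * \<i> * s0 ^ (2 * M) * of_int (fls_subdegree F)"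
      using k by (simp add: q_def \<sigma>_def algebra_simps zero_power)
  qed (use r(1) in auto)
  ultimately show False using assms(1,3) n by simp
qed

text \<open>With s = t^(-k), ds = - k t^(-k-1) dt, the curve form becomes - 2 M i k (t^(-2Mk-1) +
  t^(-(2M+1)k-1) F(t)) dt. The index k (2M + 1) in \<open>t\<close> is the exponent 2M + 1 in the
  local variable t^k at infinity.\<close>

lemma no_residue_at_infinity:
  fixes F :: "complex fls"
  assumes "M \<ge> 1" "R \<noteq> 0"
    and alg: "\<forall>\<^sub>F z in at a. algebraic_primitive R id (curve_form M g) z"
    and "puiseux_expansion (\<lambda>s. g (1 / s)) (1 / a) 0 k F"
  shows "fls_nth F (int (k * (2 * M + 1))) = 0"
proof -
  obtain t1 where k: "k \<ge> 1" and t1: "t1 \<noteq> 0" "ereal (norm t1) < fls_conv_radius F" "t1 ^ k = 1 / a"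
    and gF: "\<forall>\<^sub>F t in nhds t1. g (1 / t ^ k) = eval_fls F t"
    using assms(4) unfolding puiseux_expansion_def by auto
  obtain \<rho> where \<rho>: "norm t1 < \<rho>" "ereal \<rho> < fls_conv_radius F"
    using ereal_dense2[OF t1(2)] by auto
  have "\<rho> > 0" using \<rho>(1) norm_ge_zero le_less_trans by blast
  then have conv: "fls_conv_radius F > 0" using \<rho>(2) by (metis ereal_less(2) less_trans)
  define S :: "complex set" where "S = ball 0 \<rho> - {0}"
  have Ssub: "S \<subseteq> eball 0 (fls_conv_radius F) - {0}"
  proof
    fix t assume "t \<in> S"
    then have "ereal (norm t) < ereal \<rho>" "t \<noteq> 0" by (auto simp: S_def)
    then show "t \<in> eball 0 (fls_conv_radius F) - {0}"
      using less_trans[OF _ \<rho>(2)] by (auto simp: eball_def)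
  qed
  have S: "open S" "connected S" "t1 \<in> S"
    using t1(1) \<rho>(1) by (auto simp: S_def intro!: open_delete connected_punctured_ball)
  have holF: "eval_fls F holomorphic_on S"
    by (rule holomorphic_on_eval_fls) (use Ssub in auto)
  define \<sigma> where "\<sigma> = (\<lambda>t::complex. inverse (t ^ k))"
  have \<sigma>t1: "\<sigma> t1 = a" by (simp add: \<sigma>_def t1(3))
  define d\<sigma> where "d\<sigma> = (\<lambda>t::complex. - of_nat k * inverse (t ^ (k + 1)))"
  have d\<sigma>: "(\<sigma> has_field_derivative d\<sigma> t) (at t)" if "t \<noteq> 0" for t
  proof -
    have "(\<sigma> has_field_derivative - (of_nat k * t ^ (k - 1) * inverse ((t ^ k) ^ Suc (Suc 0)))) (at t)"
      unfolding \<sigma>_def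
      by (rule DERIV_inverse_fun) (use that in \<open>auto intro!: derivative_eq_intros\<close>)
    moreover have "- (of_nat k * t ^ (k - 1) * inverse ((t ^ k) ^ Suc (Suc 0))) = d\<sigma> t"
    proof -
      obtain m where "k = Suc m" using k by (cases k) auto
      then show ?thesis using that by (simp add: d\<sigma>_def field_simps)
    qed
    ultimately show ?thesis by simp
  qed
  define q where "q = (\<lambda>t. 2 * of_nat M * \<i> * (\<sigma> t ^ (2 * M - 1) + \<sigma> t ^ (2 * M) * eval_fls F t) * d\<sigma> t)"
  have hol: "\<sigma> holomorphic_on S" "q holomorphic_on S"
    unfolding q_def \<sigma>_def d\<sigma>_def by (intro holomorphic_intros holF; auto simp: S_def)+
  have "\<sigma> analytic_on {t1}"
    using hol(1) S analytic_at by blast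
  have evS: "\<forall>\<^sub>F t in at t1. t \<in> S"
    using S(1,3) by (intro eventually_at_in_open') auto
  have eq: "\<forall>\<^sub>F t in at t1. curve_form M g (\<sigma> t) * deriv \<sigma> t = q t"
    using evS eventually_nhds_imp_at[OF gF]
  proof eventually_elim
    case (elim t)
    then have "deriv \<sigma> t = d\<sigma> t" by (intro DERIV_imp_deriv d\<sigma>) (auto simp: S_def)
    moreover have "g (\<sigma> t) = eval_fls F t" using elim(2) by (simp add: \<sigma>_def inverse_eq_divide)
    ultimately show ?case by (simp add: q_def curve_form_def)
  qed
  have "infinite (\<sigma> ` (ball 0 \<rho> - {0}))"
  proof -
    have "\<sigma> ` (ball 0 \<rho> - {0}) = inverse ` (\<lambda>t. t ^ k) ` (ball 0 \<rho> - {0})"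
      by (simp add: image_image \<sigma>_def)
    moreover have "inj_on inverse A" for A :: "complex set" by (simp add: inj_on_def)
    ultimately show ?thesis
      using infinite_power_image_punctured_ball[OF \<open>\<rho> > 0\<close> k] by (simp add: finite_image_iff)
  qed
  moreover have "\<forall>\<^sub>F t in at t1. \<sigma> t \<noteq> \<sigma> t1"
    using eventually_power_neq[OF k, of t1] by eventually_elim (simp add: \<sigma>_def)
  ultimately have "residue q 0 = 0"
    using alg evS eq assms(2) hol S \<open>\<rho> > 0\<close> \<open>\<sigma> analytic_on {t1}\<close>
    by (intro residue_pullback_0[of R "curve_form M g" \<sigma> t1 S \<rho>]) (simp_all add: \<sigma>t1 S_def)
  moreover have "residue q 0 = - (2 * of_nat M * \<i> * of_nat k) * fls_nth F (int (k * (2 * M + 1)))"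
  proof -
    define C where "C = - (2 * of_nat M * \<i> * of_nat k)"
    define i where "i = - int (k * (2 * M) + 1)"
    define j where "j = - int (k * (2 * M + 1) + 1)"
    define q' where "q' = (\<lambda>t. C * (t powi i + t powi j * eval_fls F t))"
    have "q t = q' t" if "t \<noteq> 0" for t
    proof -
      have "\<sigma> t ^ (2 * M - 1) * inverse (t ^ (k + 1)) = inverse (t ^ (k * (2 * M) + 1))"
      proof -
        have "k * (2 * M) + 1 = k * (2 * M - 1) + (k + 1)"
          using assms(1) by (cases M) auto
        then show ?thesis
          by (simp only: \<sigma>_def power_inverse power_mult[symmetric] power_add inverse_mult_distrib)
      qed
      moreover have "\<sigma> t ^ (2 * M) * inverse (t ^ (k + 1)) = inverse (t ^ (k * (2 * M + 1) + 1))"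
      proof -
        have "k * (2 * M + 1) + 1 = k * (2 * M) + (k + 1)" by (simp add: algebra_simps)
        then show ?thesis
          by (simp only: \<sigma>_def power_inverse power_mult[symmetric] power_add inverse_mult_distrib)
      qed
      moreover have "t powi i = inverse (t ^ (k * (2 * M) + 1))" "t powi j = inverse (t ^ (k * (2 * M + 1) + 1))"
        unfolding i_def j_def by (simp_all only: power_int_minus power_int_of_nat)
      ultimately have *: "t powi i = \<sigma> t ^ (2 * M - 1) * inverse (t ^ (k + 1))"
        "t powi j = \<sigma> t ^ (2 * M) * inverse (t ^ (k + 1))" by (simp_all only:)
      show ?thesis
        unfolding q_def q'_def C_def d\<sigma>_def * by (simp only: ring_distribs mult_ac mult_minus_left mult_minus_right)
    qed
    then have "residue q 0 = residue q' 0"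
      by (intro residue_cong) (auto simp: eventually_at_filter)
    also have "q' has_laurent_expansion fls_const C * (fls_X_intpow i + fls_X_intpow j * F)"
      unfolding q'_def by (intro laurent_expansion_intros conv)
    then have "residue q' 0 = fls_residue (fls_const C * (fls_X_intpow i + fls_X_intpow j * F))"
      by (rule has_laurent_expansion_residue_0)
    also have "\<dots> = C * fls_nth F (int (k * (2 * M + 1)))"
    proof -
      \<comment> \<open>Since k and M are positive, the term that does not involve F has a pole of
        order at least 3 and contributes no residue.\<close>
      have "i \<noteq> - 1" using k assms(1) by (simp add: i_def)
      moreover have "- 1 - j = int (k * (2 * M + 1))" by (simp add: j_def)
      ultimately show ?thesis
        unfolding fls_X_intpow_times_conv_shift(1)[of j F] fls_residue_fls_const_times fls_plus_nth
        by (simp del: of_nat_mult of_nat_add)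
    qed
    finally show ?thesis by (simp add: C_def)
  qed
  ultimately show ?thesis using assms(1) k by simp
qed

section \<open>Conclusion\<close>

theorem theorem1p7:
  fixes M :: nat and c :: complex and L :: "complex fps" and f :: "complex \<Rightarrow> complex"
  assumes "M \<ge> 1" and "norm c = 1"
    and "convergent_fps L" and "fps_nth L 0 = 0"
    and "curve_type M L \<or> isolated_type M L"
    and "algebraic_param (gamma_param c M L)"
  defines "f \<equiv> (\<lambda>s. exp (eval_fps L s))"
  shows "algebraic_function f 0 \<and>
    (\<forall>s0. s0 \<noteq> 0 \<longrightarrow> \<not> has_zero_over f s0 \<and> \<not> has_pole_over f s0) \<and>
    (\<forall>k F. puiseux_at_infinity (\<lambda>s. deriv f s / f s) k F \<longrightarrow>
       fls_nth F (int (k * (2 * M + 1))) = 0)"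
proof -
  have "c \<noteq> 0" using assms(2) by auto
  have alg: "algebraic_function f 0"
    unfolding f_def by (rule algebraic_germ_relations(1)[OF assms(1) \<open>c \<noteq> 0\<close> assms(3,4,6)])
  obtain R where R: "R \<noteq> 0"
    "\<forall>\<^sub>F z in nhds 0. algebraic_primitive R id (curve_form M (\<lambda>s. deriv f s / f s)) z"
    using algebraic_germ_relations(2)[OF assms(1) \<open>c \<noteq> 0\<close> assms(3,4,6)] unfolding f_def by blast
  have f: "\<forall>\<^sub>F z in nhds 0. f z \<noteq> 0" by (simp add: f_def)
  \<comment> \<open>One statement excludes zeros and poles together, ordinary and algebraic: every
    Puiseux series over a nonzero point has order 0.\<close>
  have order_0: "fls_subdegree F = 0"
    if "pathstart p = 0" "continues_along f p g" "puiseux_expansion g (pathfinish p) s0 k F"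
      "F \<noteq> 0" "s0 \<noteq> 0" for p g k F s0
    using no_algebraic_zero_or_pole[OF assms(1) R(1) that(5,4) _ _ that(3)]
      algebraic_primitive_continues_along_logderiv[OF that(2)] R(2) f that(1) by simp
  have "\<not> has_zero_over f s0 \<and> \<not> has_pole_over f s0" if "s0 \<noteq> 0" for s0
    unfolding has_zero_over_def has_pole_over_def using order_0[OF _ _ _ _ that] by fastforce
  moreover have "fls_nth F (int (k * (2 * M + 1))) = 0"
    if F: "puiseux_at_infinity (\<lambda>s. deriv f s / f s) k F" for k F
  proof -
    obtain p g where "pathstart p = 0" and pg: "continues_along (\<lambda>s. deriv f s / f s) p g"
      "puiseux_expansion (\<lambda>s. g (1 / s)) (1 / pathfinish p) 0 k F"
      using F unfolding puiseux_at_infinity_def by blast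
    then have "\<forall>\<^sub>F z in at (pathfinish p). algebraic_primitive R id (curve_form M g) z"
      using algebraic_primitive_continues_along[OF pg(1)] R(2) by simp
    from no_residue_at_infinity[OF assms(1) R(1) this pg(2)] show ?thesis .
  qed
  ultimately show ?thesis using alg by blast
qed

end
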